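(* Let $\det_3$ be the determinant of a generic $3\times 3$ matrix, a cubic form in $9$ variables over a field $F$. Over any field $F$, the product rank and the tensor rank of $\det_3$ are at least five. If the characteristic of $F$ is not $2$, then $\mathbf{pr}(\det_3)=5$.
   Context: The product rank $\mathbf{pr}(f)$ of a degree $d$ form $f$ over a field $F$ is the smallest number $r$ such that $f=\boldsymbol{\ell}_1+\dots+\boldsymbol{\ell}_r$ where each $\boldsymbol{\ell}_i$ is a product of $d$ linear forms with coefficients in $F$. A generic matrix has independent variables as its entries. The tensor rank of $\det_3$ is its rank as a multilinear form in the three rows of the matrix (a tensor in $(F^3)^{\otimes 3}$), i.e. the smallest number $r$ of summands in an expression of it as a sum of products $\ell_1\ell_2\ell_3$ with $\ell_i$ a linear form in the variables of the $i$-th row. *)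

theory Defs
  imports "HOL-Analysis.Analysis" "HOL-Library.Poly_Mapping"
begin

text \<open>Formal polynomials with coefficients in \<^typ>\<open>'a\<close> in commuting variables indexed by
  \<^typ>\<open>'v\<close>: finitely supported maps from monomials, i.e. exponent vectors, to coefficients.
  Formal polynomials rather than polynomial functions, since the field may be finite.\<close>

type_synonym ('v, 'a) mpoly = "('v \<Rightarrow>\<^sub>0 nat) \<Rightarrow>\<^sub>0 'a"

definition Var :: "'v \<Rightarrow> ('v, 'a::comm_ring_1) mpoly" where
  "Var v = Poly_Mapping.single (Poly_Mapping.single v 1) 1"

definition Const :: "'a \<Rightarrow> ('v, 'a::comm_ring_1) mpoly" where
  "Const a = Poly_Mapping.single 0 a"

text \<open>Linear forms involving only the variables in a finite set.\<close>

definition linear_form_in :: "'v set \<Rightarrow> ('v, 'a::comm_ring_1) mpoly \<Rightarrow> bool" where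
  "linear_form_in V p \<longleftrightarrow> (\<exists>c. p = (\<Sum>v\<in>V. Const (c v) * Var v))"

text \<open>The ranks take values in \<^typ>\<open>enat\<close>, so that the infimum over an empty set of lengths is
  \<^term>\<open>\<infinity>\<close>. The parameter \<open>d\<close> is the degree of the form.\<close>

definition product_rank :: "nat \<Rightarrow> ('v::finite, 'a::comm_ring_1) mpoly \<Rightarrow> enat" where
  "product_rank d f = Inf {enat r | r. \<exists>l :: nat \<Rightarrow> nat \<Rightarrow> ('v, 'a) mpoly.
     (\<forall>i<r. \<forall>j<d. linear_form_in UNIV (l i j)) \<and> f = (\<Sum>i<r. \<Prod>j<d. l i j)}"

text \<open>Rank of a form in the entries of a matrix, as a multilinear form in the rows.\<close>

definition tensor_rank :: "('m::finite \<times> 'n::finite, 'a::comm_ring_1) mpoly \<Rightarrow> enat" where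
  "tensor_rank f = Inf {enat r | r. \<exists>l :: nat \<Rightarrow> 'm \<Rightarrow> ('m \<times> 'n, 'a) mpoly.
     (\<forall>k<r. \<forall>i. linear_form_in ({i} \<times> UNIV) (l k i)) \<and> f = (\<Sum>k<r. \<Prod>i\<in>UNIV. l k i)}"

definition generic_matrix :: "('m::finite \<times> 'n::finite, 'a::comm_ring_1) mpoly ^ 'n ^ 'm" where
  "generic_matrix = (\<chi> i j. Var (i, j))"

definition det3 :: "(3 \<times> 3, 'a::comm_ring_1) mpoly" where
  "det3 = det generic_matrix"

end

theory Submission
  imports Defs "HOL-Computational_Algebra.Fraction_Field"
begin

text \<open>Lower bound: by evaluation one may pass to polynomial functions over an infinite extension field, and
  a tensor decomposition is a product decomposition. Suppose \<open>det = (\<Sum>k<4. l k * m k * n k)\<close>. Choosing one factor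
  from each of the four products, say \<open>l\<close>, the determinant vanishes on the common kernel \<open>V\<close> of the chosen
  forms, a space of singular matrices of dimension at least five. Such a space has a common kernel vector, a
  common left kernel vector, or a common two by two block of zeros. In the last case \<open>V\<close> is the space
  of all matrices with these zeros, and exchanging \<open>l 0\<close> for \<open>m 0\<close> or \<open>n 0\<close> leads to the second case. If all of
  \<open>V\<close> kills the first basis vector, then the derivative of the determinant at \<open>Y \<in> V\<close> in the direction \<open>x\<close> is
  \<open>det (x\<^sub>1, Y\<^sub>2, Y\<^sub>3) = (\<Sum>k<4. l k x * m k Y * n k Y)\<close>. For \<open>x\<close> dual to the forms \<open>l k\<close> this exhibits quadratic
  forms \<open>Y \<mapsto> det (c, Y\<^sub>2, Y\<^sub>3)\<close>, for three linearly independent \<open>c\<close>, as products of two linear forms on a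
  hyperplane, but for at least one of the \<open>c\<close> the quadratic form has rank four there.

  Upper bound: Derksen's decomposition into five products.\<close>

section \<open>Homogeneous linear systems and linear forms on matrices\<close>

text \<open>Gaussian elimination by induction on the equations: an equation with a nonzero
  coefficient determines the unknown at its pivot \<open>p\<close>, and substitution leaves one
  equation and one unknown fewer. All dimension counts below reduce to this.\<close>

lemma homogeneous_system:
  fixes A :: "'j \<Rightarrow> 'i \<Rightarrow> 'a::field"
  assumes "finite J" "finite I" "card J < card I"
  shows "\<exists>a. (\<exists>i\<in>I. a i \<noteq> 0) \<and> (\<forall>j\<in>J. (\<Sum>i\<in>I. A j i * a i) = 0)"
  using assms
proof (induction J arbitrary: I A rule: finite_induct)
  case empty
  then have "I \<noteq> {}" by auto
  then show ?case by (intro exI[of _ "\<lambda>_. 1"]) auto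
next
  case (insert j J)
  show ?case
  proof (cases "\<forall>i\<in>I. A j i = 0")
    case True
    obtain a where a: "\<exists>i\<in>I. a i \<noteq> 0" "\<forall>k\<in>J. (\<Sum>i\<in>I. A k i * a i) = 0"
      using insert.IH[of I A] insert.prems insert.hyps by auto
    moreover have "(\<Sum>i\<in>I. A j i * a i) = 0" using True by simp
    ultimately show ?thesis by auto
  next
    case False
    then obtain p where p: "p \<in> I" "A j p \<noteq> 0" by auto
    define I' where "I' = I - {p}"
    have I': "finite I'" "I = insert p I'" "p \<notin> I'" using p insert.prems by (auto simp: I'_def)
    have "card J < card I'"
      using insert.prems insert.hyps I' by simp
    from insert.IH[OF I'(1) this, of "\<lambda>k i. A k i - A k p * A j i / A j p"]
    obtain a where a: "\<exists>i\<in>I'. a i \<noteq> 0"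
      "\<And>k. k \<in> J \<Longrightarrow> (\<Sum>i\<in>I'. (A k i - A k p * A j i / A j p) * a i) = 0" by auto
    define s where "s = (\<Sum>i\<in>I'. A j i * a i)"
    define b where "b = a(p := - s / A j p)"
    have sum_b: "(\<Sum>i\<in>I. A k i * b i) = A k p * (- s / A j p) + (\<Sum>i\<in>I'. A k i * a i)" for k
    proof -
      have "(\<Sum>i\<in>I'. A k i * b i) = (\<Sum>i\<in>I'. A k i * a i)"
        by (rule sum.cong) (use I' in \<open>auto simp: b_def\<close>)
      then show ?thesis using I' by (simp add: b_def)
    qed
    have "(\<Sum>i\<in>I. A k i * b i) = 0" if "k \<in> J" for k
    proof -
      have "0 = (\<Sum>i\<in>I'. A k i * a i - A k p / A j p * (A j i * a i))"
        using a(2)[OF that] by (simp add: algebra_simps)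
      also have "\<dots> = (\<Sum>i\<in>I'. A k i * a i) - A k p / A j p * s"
        by (simp add: sum_subtractf s_def sum_distrib_left)
      finally show ?thesis unfolding sum_b by (simp add: algebra_simps)
    qed
    moreover have "(\<Sum>i\<in>I. A j i * b i) = 0" unfolding sum_b using p by (simp add: s_def)
    moreover have "\<exists>i\<in>I. b i \<noteq> 0" using a(1) I' by (auto simp: b_def)
    ultimately show ?thesis by auto
  qed
qed

text \<open>Scalar multiplication on matrices; at this type the operation \<open>*s\<close> would
  take a vector as its scalar.\<close>

definition msc :: "'a::comm_ring_1 \<Rightarrow> 'a^3^3 \<Rightarrow> 'a^3^3" where
  "msc c X = (\<chi> i j. c * X$i$j)"

definition lin :: "('a::comm_ring_1^3^3 \<Rightarrow> 'a) \<Rightarrow> bool" where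
  "lin f \<longleftrightarrow> (\<forall>X Y. f (X + Y) = f X + f Y) \<and> (\<forall>c X. f (msc c X) = c * f X)"

lemma msc_nth [simp]: "msc c X $ i $ j = c * X$i$j"
  by (simp add: msc_def)

lemma lin_add: "lin f \<Longrightarrow> f (X + Y) = f X + f Y"
  and lin_msc: "lin f \<Longrightarrow> f (msc c X) = c * f X"
  by (auto simp: lin_def)

lemma lin_zero: "lin f \<Longrightarrow> f 0 = 0"
  using lin_msc[of f 0 0] by (simp add: msc_def zero_vec_def[symmetric])

lemma lin_diff: "lin f \<Longrightarrow> f (X - Y) = f X - f Y"
  by (metis add_diff_cancel diff_add_cancel lin_add)

lemma lin_sum: "lin f \<Longrightarrow> f (\<Sum>i\<in>I. g i) = (\<Sum>i\<in>I. f (g i))"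
  by (induction I rule: infinite_finite_induct) (auto simp: lin_zero lin_add)

lemma lin_nth [simp]: "lin (\<lambda>X. X$i$j)"
  by (simp add: lin_def)

lemma lin_const_zero [simp]: "lin (\<lambda>X. 0)"
  by (simp add: lin_def)

lemma lin_minus [simp]: "lin f \<Longrightarrow> lin g \<Longrightarrow> lin (\<lambda>X. f X - g X)"
  by (simp add: lin_def algebra_simps)

lemma msc_zero [simp]: "msc 0 X = 0"
  by (simp add: vec_eq_iff)

text \<open>The values of the forms on the \<open>X i\<close> are the coefficients of a system with
  more unknowns than equations. The conclusion speaks of the coefficients \<open>a\<close>, since
  the family \<open>X\<close> may be dependent and the combination itself may vanish.\<close>

lemma common_zero_combination:
  fixes X :: "'i \<Rightarrow> 'a::field^3^3"
  assumes "finite I" "length fs < card I" "\<And>f. f \<in> set fs \<Longrightarrow> lin f"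
  shows "\<exists>a. (\<exists>i\<in>I. a i \<noteq> 0) \<and> (\<forall>f\<in>set fs. f (\<Sum>i\<in>I. msc (a i) (X i)) = 0)"
proof -
  have "card (set fs) < card I" using assms(2) card_length[of fs] by linarith
  from homogeneous_system[OF _ assms(1) this, of "\<lambda>f i. f (X i)"]
  obtain a where "\<exists>i\<in>I. a i \<noteq> 0" "\<And>f. f \<in> set fs \<Longrightarrow> (\<Sum>i\<in>I. f (X i) * a i) = 0" by auto
  then show ?thesis
    by (intro exI[of _ a]) (auto simp: assms(3) lin_sum lin_msc mult.commute)
qed

definition munit :: "3 \<Rightarrow> 3 \<Rightarrow> 'a::comm_ring_1^3^3" where
  "munit k l = (\<chi> i j. if i = k \<and> j = l then 1 else 0)"

lemma munit_nth [simp]: "munit k l $ i $ j = (if i = k \<and> j = l then 1 else 0)"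
  by (simp add: munit_def)

lemma sum_munit_nth:
  assumes "finite S"
  shows "(\<Sum>p\<in>S. msc (a p) (munit (fst p) (snd p))) $ i $ j = (if (i, j) \<in> S then a (i, j) else 0)"
proof -
  have "(\<Sum>p\<in>S. msc (a p) (munit (fst p) (snd p))) $ i $ j
      = (\<Sum>p\<in>S. if (i, j) = p then a p else 0)"
    unfolding sum_component by (intro sum.cong) (auto simp: prod_eq_iff)
  then show ?thesis using assms by simp
qed

text \<open>The matrix units at the positions in \<open>S\<close> are independent, so here a
  nontrivial combination is a nonzero matrix.\<close>

lemma common_zero_supported:
  assumes "length fs < card S" "\<And>f. f \<in> set fs \<Longrightarrow> lin f"
  shows "\<exists>X :: 'a::field^3^3. X \<noteq> 0 \<and> (\<forall>i j. (i, j) \<notin> S \<longrightarrow> X$i$j = 0) \<and> (\<forall>f\<in>set fs. f X = 0)"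
proof -
  have S: "finite S" by (rule finite)
  from common_zero_combination[OF S assms, of "\<lambda>p. munit (fst p) (snd p)"]
  obtain a where a: "\<exists>p\<in>S. a p \<noteq> 0"
    "\<forall>f\<in>set fs. f (\<Sum>p\<in>S. msc (a p) (munit (fst p) (snd p))) = 0" by auto
  define X where "X = (\<Sum>p\<in>S. msc (a p) (munit (fst p) (snd p)))"
  have "X$i$j = (if (i, j) \<in> S then a (i, j) else 0)" for i j
    unfolding X_def by (rule sum_munit_nth[OF S])
  moreover from this have "X \<noteq> 0" using a(1) by (auto simp: vec_eq_iff)
  ultimately show ?thesis using a(2) by (intro exI[of _ X]) (auto simp: X_def)
qed

text \<open>A polynomial with infinitely many roots is zero. Applied along lines
  \<open>X + msc s Y\<close>, this compares coefficients of powers of \<open>s\<close>; every use of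
  the infinite field goes through it.\<close>

lemma cubic_zero:
  fixes a b c d :: "'a::field"
  assumes inf: "infinite (UNIV :: 'a set)" and "\<And>s. a + s * b + s^2 * c + s^3 * d = 0"
  shows "a = 0" "b = 0" "c = 0" "d = 0"
proof -
  have "poly [:a, b, c, d:] s = 0" for s
    using assms(2)[of s] by (simp add: algebra_simps power2_eq_square power3_eq_cube)
  then have "[:a, b, c, d:] = 0"
    using inf poly_roots_finite[of "[:a, b, c, d:]"] by auto
  then show "a = 0" "b = 0" "c = 0" "d = 0" by auto
qed

lemma quadratic_zero:
  fixes a b c :: "'a::field"
  assumes inf: "infinite (UNIV :: 'a set)" and "\<And>s. a + s * b + s^2 * c = 0"
  shows "a = 0" "b = 0" "c = 0"
  using cubic_zero[OF inf, of a b c 0] assms(2) by auto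

definition msubspace :: "('a::comm_ring_1^3^3) set \<Rightarrow> bool" where
  "msubspace V \<longleftrightarrow> 0 \<in> V \<and> (\<forall>X\<in>V. \<forall>Y\<in>V. X + Y \<in> V) \<and> (\<forall>c. \<forall>X\<in>V. msc c X \<in> V)"

text \<open>If \<open>f X\<close> and \<open>g Y\<close> are nonzero, then \<open>g X\<close> and
  \<open>f Y\<close> vanish, so \<open>f X * g Y\<close> is the coefficient of \<open>s\<close> in
  the product at \<open>X + msc s Y\<close>, which therefore cannot vanish on the whole
  line.\<close>

lemma product_zero_on_subspace:
  fixes f g :: "'a::field^3^3 \<Rightarrow> 'a"
  assumes inf: "infinite (UNIV :: 'a set)" and V: "msubspace V"
    and f: "lin f" and g: "lin g" and zero: "\<And>X. X \<in> V \<Longrightarrow> f X * g X = 0"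
  shows "(\<forall>X\<in>V. f X = 0) \<or> (\<forall>X\<in>V. g X = 0)"
proof (rule ccontr)
  assume "\<not> ?thesis"
  then obtain X Y where XY: "X \<in> V" "f X \<noteq> 0" "Y \<in> V" "g Y \<noteq> 0" by auto
  have "f X * g X + s * (f X * g Y + f Y * g X) + s^2 * (f Y * g Y) = 0" for s
    using zero[of "X + msc s Y"] V XY f g
    by (simp add: msubspace_def lin_add lin_msc algebra_simps power2_eq_square)
  from quadratic_zero(2)[OF inf this] zero[OF XY(1)] zero[OF XY(3)] XY show False by auto
qed

section \<open>Sums of four products and normal forms\<close>

text \<open>The factor \<open>\<kappa>\<close> absorbs the scaling of the determinant under changes
  of basis, which makes the notion stable under equivalence of matrices.\<close>

definition product_sum :: "'a::comm_ring_1 \<Rightarrow> (nat \<Rightarrow> 'a^3^3 \<Rightarrow> 'a) \<Rightarrow> (nat \<Rightarrow> 'a^3^3 \<Rightarrow> 'a)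
    \<Rightarrow> (nat \<Rightarrow> 'a^3^3 \<Rightarrow> 'a) \<Rightarrow> bool" where
  "product_sum \<kappa> l m n \<longleftrightarrow> \<kappa> \<noteq> 0 \<and> (\<forall>k<4. lin (l k) \<and> lin (m k) \<and> lin (n k)) \<and>
     (\<forall>X. \<kappa> * det X = (\<Sum>k<4. l k X * m k X * n k X))"

definition kern :: "(nat \<Rightarrow> 'a::comm_ring_1^3^3 \<Rightarrow> 'a) \<Rightarrow> ('a^3^3) set" where
  "kern l = {X. \<forall>k<4. l k X = 0}"

lemma msubspace_kern: "(\<And>k. k < 4 \<Longrightarrow> lin (l k)) \<Longrightarrow> msubspace (kern l)"
  by (auto simp: msubspace_def kern_def lin_zero lin_add lin_msc)

lemma lin_sandwich:
  "lin f \<Longrightarrow> lin (\<lambda>X. f (P ** X ** Q))"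
proof -
  have "P ** (X + Y) ** Q = P ** X ** Q + P ** Y ** Q" for X Y
    by (simp add: vec_eq_iff matrix_matrix_mult_def sum.distrib distrib_left distrib_right)
  moreover have "P ** msc c X ** Q = msc c (P ** X ** Q)" for c X
    by (simp add: vec_eq_iff matrix_matrix_mult_def sum_distrib_left sum_distrib_right mult_ac)
  ultimately show "lin f \<Longrightarrow> lin (\<lambda>X. f (P ** X ** Q))" by (simp add: lin_def)
qed

lemma product_sum_sandwich:
  fixes P Q :: "'a::field^3^3"
  assumes "product_sum \<kappa> l m n" "det P \<noteq> 0" "det Q \<noteq> 0"
  shows "product_sum (\<kappa> * (det P * det Q)) (\<lambda>k X. l k (P ** X ** Q)) (\<lambda>k X. m k (P ** X ** Q))
    (\<lambda>k X. n k (P ** X ** Q))"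
  unfolding product_sum_def
proof (intro conjI allI impI)
  show "\<kappa> * (det P * det Q) \<noteq> 0" using assms by (simp add: product_sum_def)
  fix X
  have "\<kappa> * (det P * det Q) * det X = \<kappa> * det (P ** X ** Q)" by (simp add: det_mul mult_ac)
  then show "\<kappa> * (det P * det Q) * det X = (\<Sum>k<4. l k (P ** X ** Q) * m k (P ** X ** Q) * n k (P ** X ** Q))"
    using assms(1) unfolding product_sum_def by simp
qed (use assms(1) in \<open>auto simp: product_sum_def intro: lin_sandwich\<close>)

lemma lin_transpose: "lin f \<Longrightarrow> lin (\<lambda>X. f (transpose X))"
proof -
  have "transpose (X + Y) = transpose X + transpose Y" for X Y :: "'a^3^3"
    by (simp add: vec_eq_iff transpose_def)
  moreover have "transpose (msc c X) = msc c (transpose X)" for c and X :: "'a^3^3"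
    by (simp add: vec_eq_iff transpose_def)
  ultimately show "lin f \<Longrightarrow> lin (\<lambda>X. f (transpose X))" by (simp add: lin_def)
qed

lemma product_sum_transpose:
  assumes "product_sum \<kappa> l m n"
  shows "product_sum \<kappa> (\<lambda>k X. l k (transpose X)) (\<lambda>k X. m k (transpose X)) (\<lambda>k X. n k (transpose X))"
  unfolding product_sum_def
proof (intro conjI allI impI)
  fix X
  have "\<kappa> * det (transpose X) = (\<Sum>k<4. l k (transpose X) * m k (transpose X) * n k (transpose X))"
    using assms unfolding product_sum_def by blast
  then show "\<kappa> * det X = (\<Sum>k<4. l k (transpose X) * m k (transpose X) * n k (transpose X))"
    by (simp add: det_transpose)
qed (use assms in \<open>auto simp: product_sum_def intro: lin_transpose\<close>)

lemma product_sum_permute: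
  assumes "product_sum \<kappa> l m n" "bij_betw \<pi> {..<4} {..<4}"
  shows "product_sum \<kappa> (l \<circ> \<pi>) (m \<circ> \<pi>) (n \<circ> \<pi>)"
proof -
  have "(\<Sum>k<4. l (\<pi> k) X * m (\<pi> k) X * n (\<pi> k) X) = (\<Sum>k<4. l k X * m k X * n k X)" for X
    by (rule sum.reindex_bij_betw[OF assms(2)])
  moreover have "\<pi> k < 4" if "k < 4" for k using assms(2) that by (auto simp: bij_betw_def)
  ultimately show ?thesis using assms(1) by (auto simp: product_sum_def)
qed

lemma kern_permute:
  assumes "bij_betw \<pi> {..<4} {..<4}"
  shows "kern (l \<circ> \<pi>) = kern l"
proof -
  have "(\<forall>k\<in>{..<4}. l (\<pi> k) X = 0) \<longleftrightarrow> (\<forall>k\<in>\<pi> ` {..<4}. l k X = 0)" for X by (rule ball_simps(9)[symmetric])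
  then have "(\<forall>k\<in>{..<4}. l (\<pi> k) X = 0) \<longleftrightarrow> (\<forall>k\<in>{..<4}. l k X = 0)" for X
    unfolding bij_betw_imp_surj_on[OF assms] .
  then show ?thesis by (simp add: kern_def lessThan_iff Ball_def)
qed

section \<open>Singular matrices of rank two up to equivalence\<close>

definition mat3 :: "'a \<Rightarrow> 'a \<Rightarrow> 'a \<Rightarrow> 'a \<Rightarrow> 'a \<Rightarrow> 'a \<Rightarrow> 'a \<Rightarrow> 'a \<Rightarrow> 'a::comm_ring_1 \<Rightarrow> 'a^3^3" where
  "mat3 a b c d e f g h i = vector [vector [a, b, c], vector [d, e, f], vector [g, h, i]]"

lemma mat3_nth [simp]:
  "mat3 a b c d e f g h i $ 1 $ 1 = a" "mat3 a b c d e f g h i $ 1 $ 2 = b" "mat3 a b c d e f g h i $ 1 $ 3 = c"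
  "mat3 a b c d e f g h i $ 2 $ 1 = d" "mat3 a b c d e f g h i $ 2 $ 2 = e" "mat3 a b c d e f g h i $ 2 $ 3 = f"
  "mat3 a b c d e f g h i $ 3 $ 1 = g" "mat3 a b c d e f g h i $ 3 $ 2 = h" "mat3 a b c d e f g h i $ 3 $ 3 = i"
  by (simp_all add: mat3_def)

lemma mat3_eq_iff: "X = mat3 a b c d e f g h i \<longleftrightarrow>
   X$1$1 = a \<and> X$1$2 = b \<and> X$1$3 = c \<and> X$2$1 = d \<and> X$2$2 = e \<and> X$2$3 = f \<and> X$3$1 = g \<and> X$3$2 = h \<and> X$3$3 = i"
  by (auto simp: vec_eq_iff forall_3)

lemma mat_mult_3: "((A::'a::comm_ring_1^3^3) ** B) $ i $ j = A$i$1 * B$1$j + A$i$2 * B$2$j + A$i$3 * B$3$j"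
  by (simp add: matrix_matrix_mult_def sum_3)

lemma rank2_normal_form_corner:
  fixes A :: "'a::field^3^3"
  assumes det: "det A = 0" and minor: "A$1$1 * A$2$2 - A$1$2 * A$2$1 \<noteq> 0"
  shows "\<exists>P Q. det P \<noteq> 0 \<and> det Q \<noteq> 0 \<and> P ** A ** Q = mat3 1 0 0 0 1 0 0 0 0"
proof -
  define a b e c d f g h k where "a = A$1$1" "b = A$1$2" "e = A$1$3" "c = A$2$1" "d = A$2$2" "f = A$2$3"
    "g = A$3$1" "h = A$3$2" "k = A$3$3"
  note defs = this
  define i where "i = 1 / (a * d - b * c)"
  have i: "(a * d - b * c) * i = 1" using minor by (simp add: i_def defs)
  \<comment> \<open>The upper left block of \<open>P\<close> inverts that of \<open>A\<close>, and
    the last row of \<open>P\<close> clears the last row of \<open>A\<close>, whose corner entry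
    disappears because \<open>det A = 0\<close>. Then \<open>Q\<close> clears the last
    column.\<close>
  define P where "P = mat3 (d * i) (- b * i) 0 (- c * i) (a * i) 0 ((h * c - g * d) * i) ((g * b - h * a) * i) 1"
  define Q where "Q = mat3 1 0 ((b * f - d * e) * i) 0 1 ((c * e - a * f) * i) 0 0 1"
  have A: "A = mat3 a b e c d f g h k" by (simp add: mat3_eq_iff defs)
  have k: "a * d * k + b * f * g + e * c * h - a * f * h - b * c * k - e * d * g = 0"
    using det by (simp add: A det_3)
  have "det P = i"
    unfolding det_3 P_def mat3_nth using i by algebra
  then have "det P \<noteq> 0" using i by auto
  moreover have "det Q = 1" by (simp add: Q_def det_3)
  moreover have "P ** A = mat3 1 0 ((d * e - b * f) * i) 0 1 ((a * f - c * e) * i) 0 0 0"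
  proof -
    have "d * i * a + - b * i * c = 1" using i by algebra
    moreover have "- c * i * b + a * i * d = 1" using i by algebra
    moreover have "(h * c - g * d) * i * a + (g * b - h * a) * i * c + g = 0" using i by algebra
    moreover have "(h * c - g * d) * i * b + (g * b - h * a) * i * d + h = 0" using i by algebra
    moreover have "(h * c - g * d) * i * e + (g * b - h * a) * i * f + k = 0"
      using i k by algebra
    ultimately show ?thesis by (simp add: mat3_eq_iff mat_mult_3 P_def A) (simp add: algebra_simps)
  qed
  then have "P ** A ** Q = mat3 1 0 0 0 1 0 0 0 0"
    by (simp add: mat3_eq_iff mat_mult_3 Q_def algebra_simps)
  ultimately show ?thesis by (intro exI[of _ P] exI[of _ Q]) auto
qed

text \<open>A cyclic permutation matrix; indices of type \<open>3\<close> are added modulo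
  three.\<close>

definition shift_mat :: "3 \<Rightarrow> 'a::comm_ring_1^3^3" where
  "shift_mat r = (\<chi> i j. if j = i + r then 1 else 0)"

lemma det_shift_mat: "det (shift_mat r :: 'a::comm_ring_1^3^3) = 1"
  using exhaust_3[of r] by (auto simp: det_3 shift_mat_def)

lemma shift_mat_nth: "(shift_mat r ** (A::'a::comm_ring_1^3^3) ** transpose (shift_mat s)) $ i $ j = A $ (i + r) $ (j + s)"
proof -
  have "(shift_mat r ** A) $ i $ j = A $ (i + r) $ j" for j
    by (simp add: matrix_matrix_mult_def shift_mat_def if_distrib[of "\<lambda>x. x * _"] cong: if_cong)
  then show ?thesis
    by (simp add: matrix_matrix_mult_def shift_mat_def transpose_def if_distrib[of "\<lambda>x. _ * x"] cong: if_cong)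
qed

definition rank_le_1 :: "'a::comm_ring_1^3^3 \<Rightarrow> bool" where
  "rank_le_1 A \<longleftrightarrow> (\<forall>p q p' q'. A$p$q * A$p'$q' = A$p$q' * A$p'$q)"

text \<open>Among three indices any two distinct ones are cyclically adjacent, so the nine minors on
  adjacent rows and columns are all the two by two minors up to order of rows and columns.\<close>

lemma rank_le_1I:
  fixes A :: "'a::comm_ring_1^3^3"
  assumes "\<And>r s. A$(1+r)$(1+s) * A$(2+r)$(2+s) = A$(1+r)$(2+s) * A$(2+r)$(1+s)"
  shows "rank_le_1 A"
proof -
  have comm: "x * y = z * w \<Longrightarrow> y * x = w * z" for x y z w :: 'a by (simp add: mult.commute)
  have mod3: "4 = (1::3)" "5 = (2::3)" by simp_all
  have e1: "A$1$1 * A$2$2 = A$1$2 * A$2$1"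
    using assms[of 3 3] by (simp add: mod3)
  have e2: "A$1$1 * A$2$3 = A$1$3 * A$2$1"
    using assms[of 3 2] by (simp add: mod3)
  have e3: "A$1$2 * A$2$3 = A$1$3 * A$2$2"
    using assms[of 3 1] by (simp add: mod3)
  have e4: "A$1$1 * A$3$2 = A$1$2 * A$3$1"
    using comm[OF assms[of 2 3]] by (simp add: mod3)
  have e5: "A$1$1 * A$3$3 = A$1$3 * A$3$1"
    using comm[OF assms[of 2 2]] by (simp add: mod3)
  have e6: "A$1$2 * A$3$3 = A$1$3 * A$3$2"
    using comm[OF assms[of 2 1]] by (simp add: mod3)
  have e7: "A$2$1 * A$3$2 = A$2$2 * A$3$1"
    using assms[of 1 3] by (simp add: mod3)
  have e8: "A$2$1 * A$3$3 = A$2$3 * A$3$1"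
    using assms[of 1 2] by (simp add: mod3)
  have e9: "A$2$2 * A$3$3 = A$2$3 * A$3$2"
    using assms[of 1 1] by (simp add: mod3)
  note e = e1 e2 e3 e4 e5 e6 e7 e8 e9
  show ?thesis
    unfolding rank_le_1_def forall_3
    by (intro conjI; (rule refl | rule mult.commute | rule e | rule e[symmetric]
      | (rule comm, rule e) | (rule comm, rule e[symmetric])))
qed

text \<open>Cyclic shifts of rows and columns move a nonvanishing two by two minor into the upper
  left corner.\<close>

lemma rank2_normal_form:
  fixes A :: "'a::field^3^3"
  assumes det: "det A = 0" and rank: "\<not> rank_le_1 A"
  shows "\<exists>P Q. det P \<noteq> 0 \<and> det Q \<noteq> 0 \<and> P ** A ** Q = mat3 1 0 0 0 1 0 0 0 0"
proof -
  obtain r s where rs: "A$(1+r)$(1+s) * A$(2+r)$(2+s) \<noteq> A$(1+r)$(2+s) * A$(2+r)$(1+s)"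
    using rank rank_le_1I[of A] by blast
  define B where "B = shift_mat r ** A ** transpose (shift_mat s)"
  have "det B = 0" by (simp add: B_def det_mul det)
  moreover have "B$1$1 * B$2$2 - B$1$2 * B$2$1 \<noteq> 0" using rs by (simp add: B_def shift_mat_nth)
  ultimately obtain P Q where PQ: "det P \<noteq> 0" "det Q \<noteq> 0" "P ** B ** Q = mat3 1 0 0 0 1 0 0 0 0"
    using rank2_normal_form_corner by blast
  have "det (P ** shift_mat r) \<noteq> 0" "det (transpose (shift_mat s) ** Q) \<noteq> 0"
    using PQ by (simp_all add: det_mul det_shift_mat)
  moreover have "(P ** shift_mat r) ** A ** (transpose (shift_mat s) ** Q) = mat3 1 0 0 0 1 0 0 0 0"
    using PQ(3) by (simp add: B_def matrix_mul_assoc)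
  ultimately show ?thesis by blast
qed

section \<open>Spaces of singular matrices\<close>

lemma kern_add: "(\<And>k. k < 4 \<Longrightarrow> lin (l k)) \<Longrightarrow> X \<in> kern l \<Longrightarrow> Y \<in> kern l \<Longrightarrow> X + Y \<in> kern l"
  by (auto simp: kern_def lin_add)

lemma kern_msc: "(\<And>k. k < 4 \<Longrightarrow> lin (l k)) \<Longrightarrow> X \<in> kern l \<Longrightarrow> msc c X \<in> kern l"
  by (auto simp: kern_def lin_msc)

lemma kern_supported:
  assumes "\<And>k. k < 4 \<Longrightarrow> lin (l k)" "4 + length fs < card S" "\<And>f. f \<in> set fs \<Longrightarrow> lin f"
  shows "\<exists>X :: 'a::field^3^3. X \<noteq> 0 \<and> X \<in> kern l \<and> (\<forall>i j. (i, j) \<notin> S \<longrightarrow> X$i$j = 0) \<and> (\<forall>f\<in>set fs. f X = 0)"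
proof -
  have "\<And>f. f \<in> set (map l [0..<4] @ fs) \<Longrightarrow> lin f" using assms by auto
  moreover have "length (map l [0..<4] @ fs) < card S" using assms(2) by simp
  ultimately obtain X where "X \<noteq> 0" "\<forall>i j. (i, j) \<notin> S \<longrightarrow> X$i$j = 0" "\<forall>f\<in>set (map l [0..<4] @ fs). f X = 0"
    using common_zero_supported by blast
  then show ?thesis by (intro exI[of _ X]) (auto simp: kern_def)
qed

text \<open>\<open>kern l\<close> has dimension at least five, too much for matrices of rank at most
  one. Given \<open>A\<close> with \<open>A$i$j\<close> nonzero, a nonzero \<open>X\<close> in
  \<open>kern l\<close> is found whose row \<open>i\<close> and column \<open>j\<close> vanish; then
  \<open>A\<close> and \<open>X\<close> span matrices of higher rank.\<close>

lemma exists_rank2_element: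
  fixes l :: "nat \<Rightarrow> 'a::field^3^3 \<Rightarrow> 'a"
  assumes inf: "infinite (UNIV :: 'a set)" and lin: "\<And>k. k < 4 \<Longrightarrow> lin (l k)"
  shows "\<exists>A\<in>kern l. \<not> rank_le_1 A"
proof (rule ccontr)
  assume "\<not> ?thesis"
  then have rank: "Y$p$q * Y$p'$q' = Y$p$q' * Y$p'$q" if "Y \<in> kern l" for Y p q p' q'
    using that by (auto simp: rank_le_1_def)
  have "card (UNIV :: (3 \<times> 3) set) = 9" by simp
  then obtain A where A: "A \<noteq> 0" "A \<in> kern l" using kern_supported[of l "[]" UNIV] lin by auto
  then obtain i j where ij: "A$i$j \<noteq> 0" by (auto simp: vec_eq_iff)
  \<comment> \<open>Six positions remain, against the four forms and one further condition, that the
    entries next to \<open>(i, j)\<close> in its row and in its column agree. A vanishing minor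
    makes the square of this common entry zero.\<close>
  define S where "S = UNIV - {(i, j), (i, j + 2), (i + 2, j)}"
  have "card S = 6" by (simp add: S_def card_Diff_subset)
  then obtain X where X: "X \<noteq> 0" "X \<in> kern l" "X$i$j = 0" "X$i$(j+2) = 0" "X$(i+2)$j = 0"
      and XX: "X$i$(j+1) = X$(i+1)$j"
    using kern_supported[of l "[\<lambda>X. X$i$(j+1) - X$(i+1)$j]" S] lin by (auto simp: S_def)
  have three: "k = n \<or> k = n + 1 \<or> k = n + 2" for k n :: 3
    using exhaust_3[of k] exhaust_3[of n] by auto
  have x1: "X$i$(j+1) = 0" using rank[OF X(2), of i j "i+1" "j+1"] X XX by simp
  have row: "X$i$q = 0" for q using three[of q j] X(3,4) x1 by (elim disjE) simp_all
  have col: "X$q$j = 0" for q using three[of q i] X(3,5) x1 XX by (elim disjE) simp_all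
  have "X$p$q = 0" for p q
  proof -
    \<comment> \<open>The minor of \<open>A + msc s X\<close> on rows \<open>i\<close>,
      \<open>p\<close> and columns \<open>j\<close>, \<open>q\<close> has
      \<open>A$i$j * X$p$q\<close> as its coefficient of \<open>s\<close>.\<close>
    have "A + msc s X \<in> kern l" for s using A X lin by (intro kern_add kern_msc) auto
    then have "(A$i$j * A$p$q - A$i$q * A$p$j) + s * (A$i$j * X$p$q) + s^2 * 0 = 0" for s
      using rank[of "A + msc s X" i j p q] row col by (simp add: algebra_simps)
    from quadratic_zero(2)[OF inf this] ij show ?thesis by simp
  qed
  then have "X = 0" by (simp add: vec_eq_iff)
  with X show False by simp
qed

text \<open>The block in rows two and three and columns one and three: the position compatible with
  the normal form, whose elements have nonzero entries at (1,1), (2,2), (1,3) and (3,2).\<close>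

definition zero_block :: "'a::comm_ring_1^3^3 \<Rightarrow> bool" where
  "zero_block Y \<longleftrightarrow> Y$3$3 = 0 \<and> Y$2$3 = 0 \<and> Y$3$1 = 0 \<and> Y$2$1 = 0"

lemma singular_zero_block_normalized:
  fixes l :: "nat \<Rightarrow> 'a::field^3^3 \<Rightarrow> 'a"
  assumes inf: "infinite (UNIV :: 'a set)" and lin: "\<And>k. k < 4 \<Longrightarrow> lin (l k)"
    and sing: "\<And>X. X \<in> kern l \<Longrightarrow> det X = 0"
    and A: "mat3 1 0 0 0 1 0 0 0 0 \<in> kern l"
    and X: "X \<in> kern l" "X$1$3 = 1" "X$2$3 = 0" "X$3$1 = 0" "X$3$2 = 1"
    and Y: "Y \<in> kern l"
  shows "zero_block Y"
proof -
  note closed = kern_add[of l, OF lin] kern_msc[of l, OF lin]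
  \<comment> \<open>The determinant vanishes on the line through \<open>Y\<close> in the direction
    of the rank two normal form.\<close>
  have pencil: "Y$3$3 = 0" "Y$1$3 * Y$3$1 + Y$2$3 * Y$3$2 = 0" if Y: "Y \<in> kern l" for Y
  proof -
    have "det Y + s * (Y$1$1 * Y$3$3 - Y$1$3 * Y$3$1 + Y$2$2 * Y$3$3 - Y$2$3 * Y$3$2) + s^2 * Y$3$3 = 0" for s
      using sing[of "Y + msc s (mat3 1 0 0 0 1 0 0 0 0)"] A Y closed
      by (simp add: det_3 algebra_simps power2_eq_square)
    from quadratic_zero(2,3)[OF inf this] show "Y$3$3 = 0" "Y$1$3 * Y$3$1 + Y$2$3 * Y$3$2 = 0"
      by (simp_all add: algebra_simps) (metis add.inverse_inverse add.right_inverse)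
  qed
  \<comment> \<open>Polarization of the quadratic relation in \<open>pencil\<close> against
    \<open>X\<close>.\<close>
  have polar: "Y$3$1 + Y$2$3 = 0" if Y: "Y \<in> kern l" for Y
    using pencil(2)[of "Y + X"] pencil(2)[OF Y] X Y closed by (simp add: algebra_simps)
  have prod: "Y$2$3 * (Y$3$2 - Y$1$3) = 0" if Y: "Y \<in> kern l" for Y
  proof -
    have "Y$3$1 = - Y$2$3" using polar[OF Y] by (simp add: eq_neg_iff_add_eq_0)
    then show ?thesis using pencil(2)[OF Y] by (simp add: algebra_simps)
  qed
  \<comment> \<open>If entry (2,3) is not identically zero, then entries (3,2) and (1,3) agree on
    \<open>kern l\<close>, by \<open>prod\<close>. Together with \<open>polar\<close>, the four
    vanishing entries of \<open>Z\<close> then leave only (1,2) and (2,1), and singularity of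
    \<open>X + Z\<close> excludes (2,1). Adding this multiple of a matrix unit to \<open>Y\<close>
    changes the determinant unless \<open>Y$2$3 * Y$3$1 = 0\<close>.\<close>
  have y23: "Y$2$3 = 0" if Y: "Y \<in> kern l" for Y
  proof (rule ccontr)
    assume nz: "Y$2$3 \<noteq> 0"
    have eq: "Z$3$2 = Z$1$3" if "Z \<in> kern l" for Z
      using product_zero_on_subspace[OF inf msubspace_kern[of l, OF lin], of "\<lambda>Y. Y$2$3" "\<lambda>Y. Y$3$2 - Y$1$3"]
        prod nz Y that by auto
    define S :: "(3 \<times> 3) set" where "S = UNIV - {(1, 3), (2, 3), (1, 1), (2, 2)}"
    have "card S = 5" by (simp add: S_def card_Diff_subset)
    then obtain Z where Z: "Z \<noteq> 0" "Z \<in> kern l" "Z$1$3 = 0" "Z$2$3 = 0" "Z$1$1 = 0" "Z$2$2 = 0"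
      using kern_supported[of l "[]" S] lin by (auto simp: S_def)
    have Z': "Z$3$1 = 0" "Z$3$2 = 0" "Z$3$3 = 0" using polar[OF Z(2)] eq[OF Z(2)] pencil(1)[OF Z(2)] Z by auto
    have x21: "X$2$1 = 0" using sing[OF X(1)] X by (simp add: det_3 pencil(1)[OF X(1)])
    have z21: "Z$2$1 = 0" using sing[of "X + Z"] X Z Z' closed x21 by (simp add: det_3 pencil(1)[OF X(1)])
    then have z12: "Z$1$2 \<noteq> 0" using Z Z' by (auto simp: vec_eq_iff forall_3)
    have "det (Y + Z) = 0" using sing Y Z closed by auto
    moreover have "det (Y + Z) = det Y + Z$1$2 * (Y$2$3 * Y$3$1 - Y$2$1 * Y$3$3)"
      using Z Z' z21 by (simp add: det_3 algebra_simps)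
    ultimately have "Y$2$3 * Y$3$1 = 0" using z12 sing[OF Y] pencil(1)[OF Y] by auto
    then show False using polar[OF Y] nz by auto
  qed
  have y31: "Y$3$1 = 0" if "Y \<in> kern l" for Y using y23[OF that] polar[OF that] by simp
  have zero: "(Y$1$3 * Y$3$2) * Y$2$1 = 0" if Y: "Y \<in> kern l" for Y
    using sing[OF Y] y23[OF Y] y31[OF Y] pencil(1)[OF Y] by (simp add: det_3 algebra_simps)
  have "Y$2$1 = 0"
  proof (rule ccontr)
    assume nz: "Y$2$1 \<noteq> 0"
    \<comment> \<open>The three factors of \<open>zero\<close> at \<open>Y + msc s X\<close>: two
      are monic in \<open>s\<close>, so the coefficients of \<open>s^3\<close> and
      \<open>s^2\<close> force the third to vanish.\<close>
    define f where "f s = (Y$1$3 + s) * (Y$3$2 + s) * (Y$2$1 + s * X$2$1)" for s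
    have "f s = 0" for s using zero[of "Y + msc s X"] X Y closed by (simp add: f_def)
    moreover have "f s = Y$1$3 * Y$3$2 * Y$2$1 + s * (Y$1$3 * Y$3$2 * X$2$1 + (Y$1$3 + Y$3$2) * Y$2$1)
        + s^2 * (Y$2$1 + (Y$1$3 + Y$3$2) * X$2$1) + s^3 * X$2$1" for s
      by (simp add: f_def algebra_simps power2_eq_square power3_eq_cube)
    ultimately have "Y$1$3 * Y$3$2 * Y$2$1 + s * (Y$1$3 * Y$3$2 * X$2$1 + (Y$1$3 + Y$3$2) * Y$2$1)
        + s^2 * (Y$2$1 + (Y$1$3 + Y$3$2) * X$2$1) + s^3 * X$2$1 = 0" for s by simp
    from cubic_zero(3,4)[OF inf this] nz show False by simp
  qed
  with y23[OF Y] y31[OF Y] pencil(1)[OF Y] show ?thesis by (simp add: zero_block_def)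
qed


lemma det_mult_nonzero_inverse:
  fixes P :: "'a::field^3^3"
  assumes "det P \<noteq> 0"
  obtains P' where "P ** P' = mat 1" "P' ** P = mat 1" "det P' \<noteq> 0"
proof -
  obtain P' where P': "P ** P' = mat 1" "P' ** P = mat 1"
    using assms invertible_det_nz[of P] by (auto simp: invertible_def)
  then have "det P * det P' = 1" by (metis det_I det_mul)
  then show ?thesis using that P' by (metis mult_zero_right zero_neq_one)
qed

lemma kern_sandwich:
  fixes l :: "nat \<Rightarrow> 'a::field^3^3 \<Rightarrow> 'a"
  assumes "P ** P' = mat 1" "Q' ** Q = mat 1"
  shows "X \<in> kern l \<Longrightarrow> P' ** X ** Q' \<in> kern (\<lambda>k X. l k (P ** X ** Q))"
proof -
  have "P ** (P' ** X ** Q') ** Q = (P ** P') ** X ** (Q' ** Q)" by (simp add: matrix_mul_assoc)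
  then have "P ** (P' ** X ** Q') ** Q = X" using assms by simp
  then show "X \<in> kern l \<Longrightarrow> P' ** X ** Q' \<in> kern (\<lambda>k X. l k (P ** X ** Q))" by (simp add: kern_def)
qed

lemma mat_vec_3: "((A::'a::comm_ring_1^3^3) *v x) $ i = A$i$1 * x$1 + A$i$2 * x$2 + A$i$3 * x$3"
  by (simp add: matrix_vector_mult_def sum_3)

lemma axis_3_nth [simp]: "axis (3::3) x $ 1 = 0" "axis (3::3) x $ 2 = 0" "axis (3::3) x $ 3 = x"
  by (simp_all add: axis_def)

text \<open>The alternatives are the maximal spaces of singular matrices of dimension at least five: a common
  kernel vector, a common left kernel vector, or, up to equivalence, a common two by two block of zeros.\<close>

lemma singular_space_cases:
  fixes l :: "nat \<Rightarrow> 'a::field^3^3 \<Rightarrow> 'a"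
  assumes inf: "infinite (UNIV :: 'a set)" and lin: "\<And>k. k < 4 \<Longrightarrow> lin (l k)"
    and sing: "\<And>X. X \<in> kern l \<Longrightarrow> det X = 0"
  shows "(\<exists>v. v \<noteq> 0 \<and> (\<forall>X\<in>kern l. X *v v = 0)) \<or> (\<exists>v. v \<noteq> 0 \<and> (\<forall>X\<in>kern l. transpose X *v v = 0)) \<or>
    (\<exists>P Q. det P \<noteq> 0 \<and> det Q \<noteq> 0 \<and> (\<forall>X\<in>kern l. zero_block (P ** X ** Q)))"
proof -
  obtain A where A: "A \<in> kern l" "\<not> rank_le_1 A" using exists_rank2_element[of l, OF inf lin] by auto
  from rank2_normal_form[OF sing[OF A(1)] A(2)]
  obtain P Q where PQ: "det P \<noteq> 0" "det Q \<noteq> 0" "P ** A ** Q = mat3 1 0 0 0 1 0 0 0 0" by auto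
  \<comment> \<open>The outer parts of the last column and of the last row, in coordinates where
    \<open>A\<close> is in normal form. If the column part vanishes on \<open>kern l\<close>, there
    is a common kernel vector; if the row part does, a common left kernel vector.\<close>
  define b1 b2 c1 c2 where "b1 X = (P ** X ** Q)$1$3" "b2 X = (P ** X ** Q)$2$3"
    "c1 X = (P ** X ** Q)$3$1" "c2 X = (P ** X ** Q)$3$2" for X
  note defs = this
  have lin_bc: "lin b1" "lin b2" "lin c1" "lin c2" unfolding defs
    by (rule lin_sandwich, simp)+
  have PXQ: "P ** (X + msc s A) ** Q = P ** X ** Q + msc s (mat3 1 0 0 0 1 0 0 0 0)" for X s
  proof -
    have "P ** (X + msc s A) ** Q = P ** X ** Q + msc s (P ** A ** Q)"
      by (simp add: vec_eq_iff forall_3 mat_mult_3 algebra_simps)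
    then show ?thesis by (simp add: PQ)
  qed
  have pencil: "(P ** X ** Q)$3$3 = 0" "b1 X * c1 X + b2 X * c2 X = 0" if X: "X \<in> kern l" for X
  proof -
    let ?Y = "P ** X ** Q"
    have "det ?Y + s * (?Y$1$1 * ?Y$3$3 - ?Y$1$3 * ?Y$3$1 + ?Y$2$2 * ?Y$3$3 - ?Y$2$3 * ?Y$3$2) + s^2 * ?Y$3$3 = 0" for s
    proof -
      have "X + msc s A \<in> kern l" using X A lin by (intro kern_add kern_msc) auto
      then have "det (P ** (X + msc s A) ** Q) = 0" using sing by (simp add: det_mul)
      then show ?thesis unfolding PXQ by (simp add: det_3 algebra_simps power2_eq_square)
    qed
    from quadratic_zero(2,3)[OF inf this] show "?Y$3$3 = 0" "b1 X * c1 X + b2 X * c2 X = 0"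
      unfolding defs by (simp_all add: algebra_simps) (metis add.inverse_inverse add.right_inverse)
  qed
  show ?thesis
  proof (cases "\<forall>X\<in>kern l. b1 X = 0 \<and> b2 X = 0")
    case True
    define v where "v = Q *v axis 3 1"
    have "X *v v = 0" if X: "X \<in> kern l" for X
    proof -
      have "P *v (X *v v) = (P ** X ** Q) *v axis 3 1" by (simp add: v_def matrix_vector_mul_assoc matrix_mul_assoc)
      also have "\<dots> = 0" using True X pencil(1)[OF X]
        by (simp add: vec_eq_iff forall_3 mat_vec_3 defs)
      finally show ?thesis using PQ(1) by (metis det_mult_nonzero_inverse matrix_vector_mul_assoc matrix_vector_mul_lid matrix_vector_mult_0_right)
    qed
    moreover have "v \<noteq> 0"
    proof
      assume "v = 0"
      then have "axis 3 1 = (0 :: 'a^3)" using PQ(2) unfolding v_def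
        by (metis det_mult_nonzero_inverse matrix_vector_mul_assoc matrix_vector_mul_lid matrix_vector_mult_0_right)
      then show False by (simp add: axis_eq_0_iff)
    qed
    ultimately show ?thesis by blast
  next
    case False
    show ?thesis
    proof (cases "\<forall>X\<in>kern l. c1 X = 0 \<and> c2 X = 0")
      case True
      define v where "v = transpose P *v axis 3 1"
      have "transpose X *v v = 0" if X: "X \<in> kern l" for X
      proof -
        have "transpose Q *v (transpose X *v v) = transpose (P ** X ** Q) *v axis 3 1"
          by (simp add: v_def matrix_vector_mul_assoc matrix_mul_assoc matrix_transpose_mul
              del: transpose_matrix_vector)
        also have "\<dots> = 0" using True X pencil(1)[OF X]
          by (simp add: vec_eq_iff forall_3 mat_vec_3 transpose_def defs del: transpose_matrix_vector)
        finally show ?thesis using PQ(2)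
          by (metis det_transpose det_mult_nonzero_inverse matrix_vector_mul_assoc matrix_vector_mul_lid matrix_vector_mult_0_right)
      qed
      moreover have "v \<noteq> 0"
      proof
        assume "v = 0"
        then have "axis 3 1 = (0 :: 'a^3)" using PQ(1) unfolding v_def
          by (metis det_transpose det_mult_nonzero_inverse matrix_vector_mul_assoc matrix_vector_mul_lid matrix_vector_mult_0_right)
        then show False by (simp add: axis_eq_0_iff)
      qed
      ultimately show ?thesis by blast
    next
      case cFalse: False
      \<comment> \<open>Otherwise each product of a \<open>b\<close> and a \<open>c\<close> would
        vanish on \<open>kern l\<close>, hence one of its factors, and all \<open>b\<close> or all
        \<open>c\<close> would be zero.\<close>
      have "\<exists>X\<in>kern l. (b1 X \<noteq> 0 \<or> b2 X \<noteq> 0) \<and> (c1 X \<noteq> 0 \<or> c2 X \<noteq> 0)"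
      proof (rule ccontr)
        assume "\<not> ?thesis"
        then have *: "(\<forall>X\<in>kern l. b X = 0) \<or> (\<forall>X\<in>kern l. c X = 0)" if "b \<in> {b1, b2}" "c \<in> {c1, c2}" for b c
          using product_zero_on_subspace[OF inf msubspace_kern[of l, OF lin], of b c] lin_bc that by fastforce
        show False using *[of b1 c1] *[of b1 c2] *[of b2 c1] *[of b2 c2] False cFalse by auto
      qed
      then obtain X where X: "X \<in> kern l" "b1 X \<noteq> 0 \<or> b2 X \<noteq> 0" "c1 X \<noteq> 0 \<or> c2 X \<noteq> 0" by auto
      \<comment> \<open>The vector \<open>(r1, r2)\<close> completes \<open>(b1 X, b2 X)\<close> to
        a basis with determinant one. As \<open>(c1 X, c2 X)\<close> is nonzero and annihilates the
        latter, it cannot annihilate the former, so \<open>\<mu>\<close> is nonzero.\<close>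
      obtain r1 r2 where r: "b1 X * r2 - b2 X * r1 = 1"
      proof (cases "b1 X = 0")
        case True
        then show thesis using X that[of 0 "-1 / b2 X"] by simp
      next
        case False
        then show thesis using that[of "1 / b1 X" 0] by simp
      qed
      define \<mu> where "\<mu> = c1 X * r1 + c2 X * r2"
      have bc: "b1 X * c1 X + b2 X * c2 X = 0" using pencil(2)[OF X(1)] .
      have \<mu>: "\<mu> \<noteq> 0"
      proof
        assume "\<mu> = 0"
        then have \<mu>0: "c1 X * r1 + c2 X * r2 = 0" by (simp add: \<mu>_def)
        have "c1 X = 0" using \<mu>0 bc r by algebra
        moreover have "c2 X = 0" using \<mu>0 bc r by algebra
        ultimately show False using X by simp
      qed
      \<comment> \<open>The upper left blocks of \<open>R\<close> and \<open>S\<close> are inverse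
        to each other, which preserves the normal form of \<open>A\<close>, while the last column of
        \<open>X\<close> becomes (1,0,0) and its last row (0,1,0).\<close>
      define R where "R = mat3 r2 (- r1) 0 (- b2 X) (b1 X) 0 0 0 (1 / \<mu>)"
      define S where "S = mat3 (b1 X) r1 0 (b2 X) r2 0 0 0 1"
      have detRS: "det R = 1 / \<mu>" "det S = 1" using r by (simp_all add: R_def S_def det_3 algebra_simps diff_divide_distrib[symmetric])
      define P1 Q1 where "P1 = R ** P" "Q1 = Q ** S"
      have det1: "det P1 \<noteq> 0" "det Q1 \<noteq> 0" using detRS \<mu> PQ by (simp_all add: P1_Q1_def det_mul)
      have sandwich1: "P1 ** Y ** Q1 = R ** (P ** Y ** Q) ** S" for Y
        by (simp add: P1_Q1_def matrix_mul_assoc)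
      obtain P2 where P2: "P1 ** P2 = mat 1" "P2 ** P1 = mat 1" "det P2 \<noteq> 0" using det_mult_nonzero_inverse[OF det1(1)] .
      obtain Q2 where Q2: "Q1 ** Q2 = mat 1" "Q2 ** Q1 = mat 1" "det Q2 \<noteq> 0" using det_mult_nonzero_inverse[OF det1(2)] .
      define l' where "l' = (\<lambda>k X. l k (P2 ** X ** Q2))"
      have lin': "lin (l' k)" if "k < 4" for k unfolding l'_def using lin[OF that] by (rule lin_sandwich)
      have sing': "det Y = 0" if "Y \<in> kern l'" for Y
      proof -
        have "P2 ** Y ** Q2 \<in> kern l" using that by (simp add: kern_def l'_def)
        then have "det (P2 ** Y ** Q2) = 0" by (rule sing)
        then show ?thesis using P2 Q2 by (simp add: det_mul)
      qed
      have kern': "P1 ** Y ** Q1 \<in> kern l'" if "Y \<in> kern l" for Y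
        unfolding l'_def using P2 Q2 that by (intro kern_sandwich)
      have A': "P1 ** A ** Q1 = mat3 1 0 0 0 1 0 0 0 0"
        using r unfolding sandwich1 PQ(3) by (simp add: R_def S_def mat3_eq_iff mat_mult_3 algebra_simps)
      have X': "(P1 ** X ** Q1)$1$3 = 1" "(P1 ** X ** Q1)$2$3 = 0" "(P1 ** X ** Q1)$3$1 = 0" "(P1 ** X ** Q1)$3$2 = 1"
      proof -
        note e = defs[symmetric] pencil(1)[OF X(1)]
        show "(P1 ** X ** Q1)$1$3 = 1" "(P1 ** X ** Q1)$2$3 = 0"
          using r unfolding sandwich1 mat_mult_3[of _ S] mat_mult_3[of R]
          by (simp_all add: R_def S_def e algebra_simps)
        have "(P1 ** X ** Q1)$3$1 = (b1 X * c1 X + b2 X * c2 X) / \<mu>" "(P1 ** X ** Q1)$3$2 = (c1 X * r1 + c2 X * r2) / \<mu>"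
          unfolding sandwich1 mat_mult_3[of _ S] mat_mult_3[of R]
          by (simp_all add: R_def S_def e add_divide_distrib algebra_simps)
        then show "(P1 ** X ** Q1)$3$1 = 0" "(P1 ** X ** Q1)$3$2 = 1" using bc \<mu> \<mu>_def by simp_all
      qed
      have "zero_block (P1 ** Y ** Q1)" if "Y \<in> kern l" for Y
        using singular_zero_block_normalized[where l = l' and X = "P1 ** X ** Q1" and Y = "P1 ** Y ** Q1",
            OF inf lin' sing']
          kern'[OF A(1)] kern'[OF X(1)] kern'[OF that] A' X' by simp
      then have "\<forall>Y\<in>kern l. zero_block (P1 ** Y ** Q1)" by simp
      with det1 show ?thesis by (intro disjI2 exI[of _ P1] exI[of _ Q1] conjI)
    qed
  qed
qed

section \<open>Spaces with a common kernel vector\<close>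

lemma lin_expand:
  assumes "lin t"
  shows "t Y = (\<Sum>p\<in>UNIV. Y $ fst p $ snd p * t (munit (fst p) (snd p)))"
proof -
  have "Y = (\<Sum>p\<in>UNIV. msc (Y $ fst p $ snd p) (munit (fst p) (snd p)))"
    unfolding vec_eq_iff by (intro allI) (subst sum_munit_nth, simp_all)
  then have "t Y = t (\<Sum>p\<in>UNIV. msc (Y $ fst p $ snd p) (munit (fst p) (snd p)))" by simp
  then show ?thesis using assms by (simp add: lin_sum lin_msc)
qed

text \<open>The determinant of \<open>Y\<close> with its first column replaced by \<open>c\<close>,
  a quadratic form in the last two columns.\<close>

definition col_det :: "'a::comm_ring_1^3 \<Rightarrow> 'a^3^3 \<Rightarrow> 'a" where
  "col_det c Y = c$1 * (Y$2$2 * Y$3$3 - Y$2$3 * Y$3$2) - c$2 * (Y$1$2 * Y$3$3 - Y$1$3 * Y$3$2)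
     + c$3 * (Y$1$2 * Y$2$3 - Y$1$3 * Y$2$2)"

text \<open>These matrices lie in the radical of the quadratic form
  \<open>col_det c\<close>.\<close>

definition cols_multiple :: "'a::comm_ring_1^3 \<Rightarrow> 'a \<Rightarrow> 'a \<Rightarrow> 'a^3^3" where
  "cols_multiple c a b = (\<chi> i j. if j = 2 then a * c$i else if j = 3 then b * c$i else 0)"

lemma cols_multiple_nth [simp]: "cols_multiple c a b $ i $ 1 = 0" "cols_multiple c a b $ i $ 2 = a * c$i"
  "cols_multiple c a b $ i $ 3 = b * c$i"
  by (simp_all add: cols_multiple_def)

text \<open>On the six-dimensional space of the last two columns, \<open>col_det c\<close> has a
  radical of dimension two and hence rank four, more than a product of two linear forms can have. By
  the condition on \<open>t\<close>, the zero space of \<open>t\<close> is everything or is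
  transversal to the radical, so the rank does not drop there.\<close>

lemma col_det_not_product:
  fixes c :: "'a::field^3"
  assumes c: "c \<noteq> 0" and \<kappa>: "\<kappa> \<noteq> 0" and lin: "lin t" "lin m" "lin n"
    and t: "(\<exists>a b. t (cols_multiple c a b) \<noteq> 0) \<or> (\<forall>Y. (\<forall>i. Y$i$1 = 0) \<longrightarrow> t Y = 0)"
    and eq: "\<And>Y. (\<forall>i. Y$i$1 = 0) \<Longrightarrow> t Y = 0 \<Longrightarrow> \<kappa> * col_det c Y = m Y * n Y"
  shows False
proof -
  obtain r where r: "c$r \<noteq> 0" using c by (auto simp: vec_eq_iff)
  define S :: "(3 \<times> 3) set" where "S = UNIV \<times> {2, 3}"
  have "card S = 6" by (simp add: S_def card_cartesian_product)
  moreover have lin5: "f \<in> set [t, m, n, \<lambda>Y. Y$r$2, \<lambda>Y. Y$r$3] \<Longrightarrow> lin f" for f using lin by auto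
  \<comment> \<open>\<open>Y\<close> is invisible to \<open>t\<close>, \<open>m\<close> and
    \<open>n\<close>, hence will lie in the radical; the zero entries in row \<open>r\<close>, where
    \<open>c\<close> is nonzero, then force \<open>Y = 0\<close>.\<close>
  ultimately obtain Y where Y: "Y \<noteq> 0" "\<forall>i j. (i, j) \<notin> S \<longrightarrow> Y$i$j = 0"
      "\<forall>f\<in>set [t, m, n, \<lambda>Y. Y$r$2, \<lambda>Y. Y$r$3]. f Y = 0"
    using common_zero_supported[of "[t, m, n, \<lambda>Y. Y$r$2, \<lambda>Y. Y$r$3]" S] by auto
  have Y1: "Y$i$1 = 0" for i using Y(2) by (simp add: S_def)
  have Y0: "t Y = 0" "m Y = 0" "n Y = 0" "Y$r$2 = 0" "Y$r$3 = 0" using Y(3) by auto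
  have inv0: "col_det c (Y + Z) = col_det c Z" if Z: "\<forall>i. Z$i$1 = 0" "t Z = 0" for Z
  proof -
    have "\<kappa> * col_det c (Y + Z) = m (Y + Z) * n (Y + Z)"
      using Z Y1 Y0 lin by (intro eq) (simp_all add: lin_add)
    also have "\<dots> = \<kappa> * col_det c Z" using eq[of Z] Z Y0 lin by (simp add: lin_add)
    finally show ?thesis using \<kappa> by simp
  qed
  have inv: "col_det c (Y + Z) = col_det c Z" if Z: "\<forall>i. Z$i$1 = 0" for Z
  proof (cases "t Z = 0")
    case True
    then show ?thesis using inv0 Z by simp
  next
    case False
    then obtain a b where ab: "t (cols_multiple c a b) \<noteq> 0" using t Z by auto
    \<comment> \<open>A translation inside the radical moves \<open>Z\<close> into the hyperplane
      \<open>t = 0\<close> without changing \<open>col_det c\<close>.\<close>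
    define W where "W = msc (- t Z / t (cols_multiple c a b)) (cols_multiple c a b)"
    have W: "\<forall>i. W$i$1 = 0" "t (Z + W) = 0" using lin ab by (simp_all add: W_def lin_add lin_msc)
    have add_W: "col_det c (X + W) = col_det c X" for X
      by (simp add: col_det_def W_def algebra_simps)
    show ?thesis using inv0[of "Z + W"] W Z add_W[of "Y + Z"] add_W[of Z] by (simp add: add.assoc)
  qed
  have "col_det c Y = 0" using inv[of 0] by (simp add: col_det_def)
  then have "c$i * Y$j$2 = c$j * Y$i$2 \<and> c$i * Y$j$3 = c$j * Y$i$3" for i j
    using inv[of "munit 1 3"] inv[of "munit 2 3"] inv[of "munit 3 3"]
      inv[of "munit 1 2"] inv[of "munit 2 2"] inv[of "munit 3 2"] exhaust_3[of i] exhaust_3[of j]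
    by (auto simp: col_det_def algebra_simps)
  then have "Y$j$2 = 0 \<and> Y$j$3 = 0" for j using r Y0 by (metis mult_eq_0_iff)
  then have "Y = 0" using Y1 by (simp add: vec_eq_iff forall_3)
  with Y show False by simp
qed

text \<open>Spanning is expressed by orthogonality: only zero is orthogonal to all
  \<open>c i\<close>. If \<open>t\<close> is nonzero on the last two columns, its coefficients on
  some column \<open>j\<close> form a nonzero vector \<open>u\<close>, and a \<open>c i\<close> not
  orthogonal to \<open>u\<close> satisfies the transversality condition of
  \<open>col_det_not_product\<close>.\<close>

lemma col_det_products_not_spanning:
  fixes c :: "nat \<Rightarrow> 'a::field^3"
  assumes \<kappa>: "\<kappa> \<noteq> 0" and lin: "lin t" "\<And>i. i \<in> I \<Longrightarrow> lin (m i) \<and> lin (n i)"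
    and span: "\<And>u. (\<And>i. i \<in> I \<Longrightarrow> (\<Sum>r\<in>UNIV. u$r * c i$r) = 0) \<Longrightarrow> u = 0"
    and eq: "\<And>Y i. (\<forall>i. Y$i$1 = 0) \<Longrightarrow> t Y = 0 \<Longrightarrow> i \<in> I \<Longrightarrow> \<kappa> * col_det (c i) Y = m i Y * n i Y"
  shows False
proof (cases "\<forall>Y. (\<forall>i. Y$i$1 = 0) \<longrightarrow> t Y = 0")
  case True
  have "axis 1 1 \<noteq> (0 :: 'a^3)" by (simp add: axis_eq_0_iff)
  then obtain i where i: "i \<in> I" "(\<Sum>r\<in>UNIV. axis 1 1 $ r * c i$r) \<noteq> 0" using span by blast
  then have "c i \<noteq> 0" by auto
  with i show False using col_det_not_product[of "c i" \<kappa> t "m i" "n i"] \<kappa> lin True eq by blast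
next
  case False
  then obtain Y where Y: "\<forall>i. Y$i$1 = 0" "t Y \<noteq> 0" by auto
  then have "(\<Sum>p\<in>UNIV. Y $ fst p $ snd p * t (munit (fst p) (snd p))) \<noteq> 0"
    using lin_expand[OF lin(1)] by metis
  then obtain p where p: "Y $ fst p $ snd p * t (munit (fst p) (snd p)) \<noteq> 0" by (meson sum.neutral)
  define j where "j = snd p"
  have j: "j \<noteq> 1" "t (munit (fst p) j) \<noteq> 0" using p Y by (auto simp: j_def)
  define u :: "'a^3" where "u = (\<chi> r. t (munit r j))"
  have "u \<noteq> 0" using j(2) by (auto simp: u_def vec_eq_iff)
  then obtain i where i: "i \<in> I" "(\<Sum>r\<in>UNIV. u$r * c i$r) \<noteq> 0" using span by blast
  then have c: "c i \<noteq> 0" by auto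
  define a b where "a = (if j = 2 then 1 else 0 :: 'a)" "b = (if j = 3 then 1 else 0 :: 'a)"
  have "cols_multiple (c i) a b = msc (c i$1) (munit 1 j) + msc (c i$2) (munit 2 j) + msc (c i$3) (munit 3 j)"
    using j(1) exhaust_3[of j] by (auto simp: vec_eq_iff forall_3 a_b_def)
  then have "t (cols_multiple (c i) a b) = (\<Sum>r\<in>UNIV. u$r * c i$r)"
    using lin by (simp add: u_def sum_3 lin_add lin_msc mult.commute)
  then have "\<exists>a b. t (cols_multiple (c i) a b) \<noteq> 0" using i by (intro exI[of _ a] exI[of _ b]) simp
  with i show False using col_det_not_product[of "c i" \<kappa> t "m i" "n i"] \<kappa> lin c eq by blast
qed

text \<open>Comparing the coefficients of \<open>s\<close> in \<open>\<kappa> det (Y + s x)\<close>.\<close>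

lemma product_sum_derivative:
  fixes l m n :: "nat \<Rightarrow> 'a::field^3^3 \<Rightarrow> 'a"
  assumes inf: "infinite (UNIV :: 'a set)" and ps: "product_sum \<kappa> l m n"
    and Y: "Y \<in> kern l" "\<And>i. Y$i$1 = 0"
  shows "\<kappa> * col_det (column 1 x) Y = (\<Sum>k<4. l k x * m k Y * n k Y)"
proof -
  \<comment> \<open>The coefficient of \<open>s^2\<close> in \<open>det (Y + msc s x)\<close>; there
    is no constant term, because the first column of \<open>Y\<close> is zero.\<close>
  define P where "P = x$1$1 * (Y$2$2 * x$3$3 + x$2$2 * Y$3$3 - Y$2$3 * x$3$2 - x$2$3 * Y$3$2)
     - x$2$1 * (Y$1$2 * x$3$3 + x$1$2 * Y$3$3 - Y$1$3 * x$3$2 - x$1$3 * Y$3$2)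
     + x$3$1 * (Y$1$2 * x$2$3 + x$1$2 * Y$2$3 - Y$1$3 * x$2$2 - x$1$3 * Y$2$2)"
  define A B C where "A = (\<Sum>k<4. l k x * m k Y * n k Y)"
    "B = (\<Sum>k<4. l k x * (m k x * n k Y + m k Y * n k x))" "C = (\<Sum>k<4. l k x * m k x * n k x)"
  have "0 + s * (\<kappa> * col_det (column 1 x) Y - A) + s^2 * (\<kappa> * P - B) + s^3 * (\<kappa> * det x - C) = 0" for s
  proof -
    have "det (Y + msc s x) = s * col_det (column 1 x) Y + s^2 * P + s^3 * det x"
      by (simp add: det_3 Y P_def col_det_def column_def algebra_simps power2_eq_square power3_eq_cube)
    moreover have "(\<Sum>k<4. l k (Y + msc s x) * m k (Y + msc s x) * n k (Y + msc s x)) = s * A + s^2 * B + s^3 * C"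
    proof -
      have "l k (Y + msc s x) * m k (Y + msc s x) * n k (Y + msc s x) = s * (l k x * m k Y * n k Y)
          + s^2 * (l k x * (m k x * n k Y + m k Y * n k x)) + s^3 * (l k x * m k x * n k x)" if "k < 4" for k
      proof -
        have "lin (l k)" "lin (m k)" "lin (n k)" "l k Y = 0" using ps Y that by (auto simp: product_sum_def kern_def)
        then show ?thesis by (simp add: lin_add lin_msc algebra_simps power2_eq_square power3_eq_cube)
      qed
      then show ?thesis by (simp add: A_B_C_def sum.distrib sum_distrib_left)
    qed
    moreover have "\<kappa> * det (Y + msc s x) = (\<Sum>k<4. l k (Y + msc s x) * m k (Y + msc s x) * n k (Y + msc s x))"
      using ps unfolding product_sum_def by blast
    ultimately show ?thesis by (simp add: algebra_simps)
  qed
  from cubic_zero(2)[OF inf this] show ?thesis by (simp add: A_B_C_def)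
qed

lemma sum_lessThan_4: "(\<Sum>k<(4::nat). f k) = f 0 + f 1 + f 2 + (f 3 :: 'a::comm_monoid_add)"
  by (simp add: numeral_eq_Suc add.assoc)

text \<open>Modulo \<open>kern l\<close>, every \<open>X\<close> equals the sum of the
  \<open>l i X\<close> times \<open>x i\<close>. Since \<open>kern l\<close> has zero first columns,
  the first columns of the \<open>x i\<close> span all columns.\<close>

lemma first_column_span:
  fixes l :: "nat \<Rightarrow> 'a::field^3^3 \<Rightarrow> 'a"
  assumes lin: "\<And>k. k < 4 \<Longrightarrow> lin (l k)" and col: "\<And>X i. X \<in> kern l \<Longrightarrow> X$i$1 = 0"
    and I: "I \<subseteq> {..<4}" and dual: "\<And>i k. i \<in> I \<Longrightarrow> k \<in> I \<Longrightarrow> l k (x i) = (if k = i then 1 else 0)"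
    and kern: "\<And>X. (\<And>k. k \<in> I \<Longrightarrow> l k X = 0) \<Longrightarrow> X \<in> kern l"
    and u: "\<And>i. i \<in> I \<Longrightarrow> (\<Sum>r\<in>UNIV. u$r * x i$r$1) = 0"
  shows "u = 0"
proof -
  have fin: "finite I" using I finite_subset by blast
  have col_eq: "X$r$1 = (\<Sum>i\<in>I. l i X * x i$r$1)" for X r
  proof -
    define Z where "Z = X - (\<Sum>i\<in>I. msc (l i X) (x i))"
    have "l k Z = 0" if k: "k \<in> I" for k
    proof -
      have "lin (l k)" using lin I k by auto
      then have "l k Z = l k X - (\<Sum>i\<in>I. l i X * l k (x i))"
        by (simp add: Z_def lin_diff lin_sum lin_msc)
      also have "(\<Sum>i\<in>I. l i X * l k (x i)) = (\<Sum>i\<in>I. if k = i then l i X else 0)"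
        by (rule sum.cong) (auto simp: dual k)
      finally show ?thesis using k fin by simp
    qed
    then have "Z$r$1 = 0" using kern col by blast
    then show ?thesis by (simp add: Z_def sum_component)
  qed
  have "(\<Sum>r\<in>UNIV. u$r * X$r$1) = (\<Sum>i\<in>I. l i X * (\<Sum>r\<in>UNIV. u$r * x i$r$1))" for X
    unfolding col_eq[of X] sum_distrib_left by (subst sum.swap) (simp add: mult_ac)
  then have "(\<Sum>r\<in>UNIV. u$r * X$r$1) = 0" for X :: "'a^3^3" using u by simp
  then have "u$r = 0" for r
  proof -
    have "(\<Sum>q\<in>UNIV. u$q * munit r 1$q$1) = (\<Sum>q\<in>UNIV. if q = r then u$q else 0)" by (rule sum.cong) auto
    then show ?thesis using \<open>\<And>X. (\<Sum>r\<in>UNIV. u$r * X$r$1) = 0\<close>[of "munit r 1"] by simp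
  qed
  then show ?thesis by (simp add: vec_eq_iff)
qed

text \<open>The case of four independent forms with dual matrices \<open>x\<close>. Since
  \<open>a 0\<close> is nonzero, the first columns of \<open>x 1\<close>, \<open>x 2\<close>,
  \<open>x 3\<close> already span; for \<open>Y\<close> with zero first column and
  \<open>l 0 Y = 0\<close>, the derivative in the direction \<open>x i\<close> is the product
  \<open>m i Y * n i Y\<close>.\<close>

lemma no_common_kernel_axis_indep:
  fixes l m n :: "nat \<Rightarrow> 'a::field^3^3 \<Rightarrow> 'a"
  assumes inf: "infinite (UNIV :: 'a set)" and ps: "product_sum \<kappa> l m n"
    and col: "\<And>X i. X \<in> kern l \<Longrightarrow> X$i$1 = 0"
    and dual: "\<And>i k. i < 4 \<Longrightarrow> k < 4 \<Longrightarrow> l k (x i) = (if k = i then 1 else 0)"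
    and a: "a 0 \<noteq> 0" "\<And>r. (\<Sum>i<4. x i$r$1 * a i) = 0"
  shows False
proof (rule col_det_products_not_spanning)
  have lin: "\<And>k. k < 4 \<Longrightarrow> lin (l k) \<and> lin (m k) \<and> lin (n k)" using ps by (simp add: product_sum_def)
  show "\<kappa> \<noteq> 0" using ps by (simp add: product_sum_def)
  show "lin (l 0)" using lin by simp
  let ?I = "{1, 2, 3 :: nat}"
  show "lin (m i) \<and> lin (n i)" if "i \<in> ?I" for i using lin that by auto
  define c where "c i = column 1 (x i)" for i
  have c_nth: "c i$r = x i$r$1" for i r by (simp add: c_def column_def)
  have span: "u = 0" if u: "\<And>i. i \<in> ?I \<Longrightarrow> (\<Sum>r\<in>UNIV. u$r * c i$r) = 0" for u
  proof (rule first_column_span[of l "{..<4}" x])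
    have "0 = (\<Sum>r\<in>UNIV. u$r * (\<Sum>i<4. x i$r$1 * a i))" using a by simp
    also have "\<dots> = (\<Sum>i<4. a i * (\<Sum>r\<in>UNIV. u$r * c i$r))"
      by (simp add: sum_distrib_left mult_ac c_nth) (subst sum.swap, rule refl)
    also have "\<dots> = a 0 * (\<Sum>r\<in>UNIV. u$r * c 0$r)" using u by (simp add: sum_lessThan_4)
    finally have "(\<Sum>r\<in>UNIV. u$r * c 0$r) = 0" using a by simp
    then show "(\<Sum>r\<in>UNIV. u$r * x i$r$1) = 0" if "i \<in> {..<4}" for i
    proof (cases "i = 0")
      case False
      then have "i \<in> ?I" using that by auto
      then show ?thesis using u unfolding c_nth by blast
    qed (simp add: c_nth)
  qed (use lin col dual in \<open>auto simp: kern_def\<close>)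
  then show "u = 0" if "\<And>i. i \<in> ?I \<Longrightarrow> (\<Sum>r\<in>UNIV. u$r * c i$r) = 0" for u using that .
  fix Y :: "'a^3^3" and i
  assume Y: "\<forall>i. Y$i$1 = 0" "l 0 Y = 0" and i: "i \<in> ?I"
  \<comment> \<open>\<open>Y\<close> minus its expansion in the \<open>x i\<close> lies in
    \<open>kern l\<close>, so its first column vanishes, as does that of \<open>Y\<close>.\<close>
  have rel: "(\<Sum>i\<in>?I. l i Y * c i$r) = 0" for r
  proof -
    define Z where "Z = Y - (\<Sum>i<4. msc (l i Y) (x i))"
    have "l k Z = 0" if k: "k < 4" for k
    proof -
      have "lin (l k)" using lin k by auto
      then have "l k Z = l k Y - (\<Sum>i<4. l i Y * l k (x i))"
        by (simp add: Z_def lin_diff lin_sum lin_msc)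
      also have "(\<Sum>i<4. l i Y * l k (x i)) = (\<Sum>i<4. if k = i then l i Y else 0)"
        by (rule sum.cong) (auto simp: dual k)
      finally show ?thesis using k by simp
    qed
    then have "Z$r$1 = 0" using col by (simp add: kern_def)
    then have "(\<Sum>i<4. l i Y * c i$r) = 0" using Y by (simp add: Z_def sum_component c_nth)
    then show ?thesis using Y by (simp add: sum_lessThan_4 add.assoc)
  qed
  \<comment> \<open>Three spanning vectors in dimension three are independent: otherwise a nonzero
    \<open>u\<close> orthogonal to the two others would by \<open>rel\<close> also be orthogonal to
    \<open>c k\<close>.\<close>
  have zero: "l k Y = 0" if k: "k \<in> ?I" for k
  proof (rule ccontr)
    assume nz: "l k Y \<noteq> 0"
    have "card (?I - {k}) < card (UNIV :: 3 set)" using k by auto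
    from homogeneous_system[OF _ _ this, of "\<lambda>i r. c i$r"]
    obtain b where b: "\<exists>r. b r \<noteq> 0" "\<And>i. i \<in> ?I - {k} \<Longrightarrow> (\<Sum>r\<in>UNIV. c i$r * b r) = 0" by auto
    define u where "u = (\<chi> r. b r)"
    have uc: "(\<Sum>r\<in>UNIV. u$r * c i$r) = 0" if "i \<in> ?I - {k}" for i
      using b(2)[OF that] by (simp add: u_def mult.commute)
    have "0 = (\<Sum>r\<in>UNIV. u$r * (\<Sum>i\<in>?I. l i Y * c i$r))" using rel by simp
    also have "\<dots> = (\<Sum>i\<in>?I. l i Y * (\<Sum>r\<in>UNIV. u$r * c i$r))"
      unfolding sum_distrib_left by (subst sum.swap) (simp add: mult_ac)
    also have "\<dots> = l k Y * (\<Sum>r\<in>UNIV. u$r * c k$r) + (\<Sum>i\<in>?I - {k}. l i Y * (\<Sum>r\<in>UNIV. u$r * c i$r))"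
      using k by (intro sum.remove) auto
    also have "(\<Sum>i\<in>?I - {k}. l i Y * (\<Sum>r\<in>UNIV. u$r * c i$r)) = 0" by (intro sum.neutral) (simp add: uc)
    finally have "(\<Sum>r\<in>UNIV. u$r * c k$r) = 0" using nz by simp
    then have "u = 0" using uc by (intro span) blast
    then show False using b(1) by (auto simp: u_def vec_eq_iff)
  qed
  have "Y \<in> kern l"
  proof -
    have "l k Y = 0" if "k < 4" for k
    proof (cases "k = 0")
      case False
      then have "k \<in> ?I" using that by auto
      then show ?thesis by (rule zero)
    qed (use Y in simp)
    then show ?thesis by (simp add: kern_def)
  qed
  then have "\<kappa> * col_det (column 1 (x i)) Y = (\<Sum>k<4. l k (x i) * m k Y * n k Y)"
    using product_sum_derivative[OF inf ps] Y by blast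
  also have "\<dots> = (\<Sum>k<4. if k = i then m k Y * n k Y else 0)"
    using i by (intro sum.cong) (auto simp: dual)
  finally show "\<kappa> * col_det (c i) Y = m i Y * n i Y" using i by (auto simp: c_def)
qed

text \<open>The case where \<open>l 0\<close> depends on the other three forms. Then
  \<open>kern l\<close> has codimension at most three and so consists of all matrices with zero
  first column; restricting to \<open>m 0 Y = 0\<close> removes the term with index 0 from the
  derivative.\<close>

lemma no_common_kernel_axis_dep:
  fixes l m n :: "nat \<Rightarrow> 'a::field^3^3 \<Rightarrow> 'a"
  assumes inf: "infinite (UNIV :: 'a set)" and ps: "product_sum \<kappa> l m n"
    and col: "\<And>X i. X \<in> kern l \<Longrightarrow> X$i$1 = 0"
    and dep: "\<And>X. (\<And>k. k \<in> {1, 2, 3} \<Longrightarrow> l k X = 0) \<Longrightarrow> l 0 X = 0"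
  shows False
proof -
  let ?I = "{1, 2, 3 :: nat}"
  have lin: "\<And>k. k < 4 \<Longrightarrow> lin (l k) \<and> lin (m k) \<and> lin (n k)" using ps by (simp add: product_sum_def)
  have kern: "X \<in> kern l" if X: "\<And>k. k \<in> ?I \<Longrightarrow> l k X = 0" for X
  proof -
    have "l k X = 0" if "k < 4" for k
    proof (cases "k = 0")
      case False
      then have "k \<in> ?I" using that by auto
      then show ?thesis by (rule X)
    qed (use dep X in blast)
    then show ?thesis by (simp add: kern_def)
  qed
  have lin_I: "lin f" if "f \<in> set [l 1, l 2, l 3]" for f using that lin by auto
  have all_col: "Y \<in> kern l" if Y: "\<And>i. Y$i$1 = 0" for Y
  proof -
    define S :: "(3 \<times> 3) set" where "S = {(1,1), (2,1), (3,1), (1,2)}"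
    \<comment> \<open>The index \<open>(1, 2)\<close> stands for \<open>Y\<close>: three forms have
      a common zero among combinations of \<open>Y\<close> and the three units of the first column,
      and the units drop out because of \<open>col\<close>.\<close>
    define Z where "Z p = (if p = (1, 2) then Y else munit (fst p) (snd p))" for p
    have "length [l 1, l 2, l 3] < card S" by (simp add: S_def)
    from common_zero_combination[OF _ this lin_I, of Z] obtain a where a: "\<exists>p\<in>S. a p \<noteq> 0"
      "\<forall>f\<in>set [l 1, l 2, l 3]. f (\<Sum>p\<in>S. msc (a p) (Z p)) = 0" by auto
    define W where "W = (\<Sum>p\<in>S. msc (a p) (Z p))"
    have "W \<in> kern l" using a(2) by (intro kern) (auto simp: W_def)
    moreover have W: "W = msc (a (1,1)) (munit 1 1) + msc (a (2,1)) (munit 2 1) + msc (a (3,1)) (munit 3 1) + msc (a (1,2)) Y"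
      by (simp add: W_def S_def Z_def add.assoc)
    ultimately have "a (1,1) = 0" "a (2,1) = 0" "a (3,1) = 0"
      using col[of W 1] col[of W 2] col[of W 3] Y by simp_all
    then have "a (1,2) \<noteq> 0" "W = msc (a (1,2)) Y" using a(1) W by (auto simp: S_def)
    then show ?thesis using \<open>W \<in> kern l\<close> lin by (auto simp: kern_def lin_msc)
  qed
  \<comment> \<open>Independence of the three forms: if \<open>l i\<close> vanished wherever the
    other two do, some nonzero matrix supported in the first column would lie in
    \<open>kern l\<close>.\<close>
  have "\<exists>x. l i x \<noteq> 0 \<and> (\<forall>k\<in>?I - {i}. l k x = 0)" if i: "i \<in> ?I" for i
  proof (rule ccontr)
    assume contr: "\<not> ?thesis"
    define fs where "fs = map l (filter (\<lambda>k. k \<noteq> i) [1, 2, 3])"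
    define S :: "(3 \<times> 3) set" where "S = {(1,1), (2,1), (3,1)}"
    have set_fs: "set fs = l ` (?I - {i})" unfolding fs_def set_map set_filter by auto
    have "length fs < card S" using i by (auto simp: fs_def S_def)
    moreover have "\<And>f. f \<in> set fs \<Longrightarrow> lin f" using lin unfolding set_fs by auto
    ultimately obtain X where X: "X \<noteq> 0" "\<forall>i j. (i, j) \<notin> S \<longrightarrow> X$i$j = 0" "\<forall>f\<in>set fs. f X = 0"
      using common_zero_supported by blast
    then have "\<forall>k\<in>?I - {i}. l k X = 0" unfolding set_fs by simp
    then have "X \<in> kern l" using contr by (intro kern) blast
    then have "X = 0" using col X(2) by (simp add: S_def vec_eq_iff forall_3)
    with X show False by simp
  qed
  then obtain x0 where x0: "\<And>i. i \<in> ?I \<Longrightarrow> l i (x0 i) \<noteq> 0 \<and> (\<forall>k\<in>?I - {i}. l k (x0 i) = 0)" by metis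
  define x where "x i = msc (1 / l i (x0 i)) (x0 i)" for i
  have dual: "l k (x i) = (if k = i then 1 else 0)" if "i \<in> ?I" "k \<in> ?I" for i k
  proof -
    have "lin (l k)" using lin that by auto
    then show ?thesis using x0[OF that(1)] that(2) by (auto simp: x_def lin_msc)
  qed
  define c where "c i = column 1 (x i)" for i
  have c_nth: "c i$r = x i$r$1" for i r by (simp add: c_def column_def)
  show False
  proof (rule col_det_products_not_spanning[of \<kappa> "m 0" ?I m n c])
    show "\<kappa> \<noteq> 0" using ps by (simp add: product_sum_def)
    show "lin (m 0)" using lin by simp
    show "lin (m i) \<and> lin (n i)" if "i \<in> ?I" for i using lin that by auto
    show "u = 0" if "\<And>i. i \<in> ?I \<Longrightarrow> (\<Sum>r\<in>UNIV. u$r * c i$r) = 0" for u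
      using that unfolding c_nth
      by (intro first_column_span[of l ?I x]) (use lin col dual kern in auto)
    fix Y :: "'a^3^3" and i
    assume Y: "\<forall>i. Y$i$1 = 0" "m 0 Y = 0" and i: "i \<in> ?I"
    have "\<kappa> * col_det (column 1 (x i)) Y = (\<Sum>k<4. l k (x i) * m k Y * n k Y)"
      using product_sum_derivative[OF inf ps] Y all_col by blast
    also have "\<dots> = (\<Sum>k<4. if k = i then m k Y * n k Y else 0)"
    proof (rule sum.cong)
      fix k assume k: "k \<in> {..<4::nat}"
      show "l k (x i) * m k Y * n k Y = (if k = i then m k Y * n k Y else 0)"
      proof (cases "k = 0")
        case False
        then have "k \<in> ?I" using k by auto
        then show ?thesis using dual[OF i] by simp
      qed (use Y i in auto)
    qed simp
    finally show "\<kappa> * col_det (c i) Y = m i Y * n i Y" using i by (auto simp: c_def)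
  qed
qed

definition swap0 :: "nat \<Rightarrow> nat \<Rightarrow> nat" where
  "swap0 i k = (if k = 0 then i else if k = i then 0 else k)"

lemma bij_swap0: "i < 4 \<Longrightarrow> bij_betw (swap0 i) {..<4} {..<4}"
  by (rule bij_betw_byWitness[where f' = "swap0 i"]) (auto simp: swap0_def)

text \<open>If the forms are independent, the first columns of the four dual matrices satisfy a
  nontrivial relation in dimension three; otherwise one form depends on the rest. In both cases
  \<open>swap0\<close> moves the distinguished index to 0.\<close>

lemma no_common_kernel_axis:
  fixes l m n :: "nat \<Rightarrow> 'a::field^3^3 \<Rightarrow> 'a"
  assumes inf: "infinite (UNIV :: 'a set)" and ps: "product_sum \<kappa> l m n"
    and col: "\<And>X i. X \<in> kern l \<Longrightarrow> X$i$1 = 0"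
  shows False
proof -
  have lin: "\<And>k. k < 4 \<Longrightarrow> lin (l k)" using ps by (simp add: product_sum_def)
  have permuted: "product_sum \<kappa> (l \<circ> swap0 i) (m \<circ> swap0 i) (n \<circ> swap0 i)" "kern (l \<circ> swap0 i) = kern l" if "i < 4" for i
    using product_sum_permute[OF ps bij_swap0[OF that]] kern_permute[OF bij_swap0[OF that]] by auto
  have swap_less: "swap0 i k < 4" if "i < 4" "k < 4" for i k using that by (simp add: swap0_def)
  show False
  proof (cases "\<forall>i<4. \<exists>x. l i x \<noteq> 0 \<and> (\<forall>k<4. k \<noteq> i \<longrightarrow> l k x = 0)")
    case True
    then obtain x0 where x0: "\<And>i. i < 4 \<Longrightarrow> l i (x0 i) \<noteq> 0 \<and> (\<forall>k<4. k \<noteq> i \<longrightarrow> l k (x0 i) = 0)" by metis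
    define x where "x i = msc (1 / l i (x0 i)) (x0 i)" for i
    have dual: "l k (x i) = (if k = i then 1 else 0)" if "i < 4" "k < 4" for i k
      using x0[OF that(1)] that lin[OF that(2)] by (auto simp: x_def lin_msc)
    have "card (UNIV :: 3 set) < card {..<4::nat}" by simp
    from homogeneous_system[OF _ _ this, of "\<lambda>r i. x i$r$1"] obtain a i
      where a: "i < 4" "a i \<noteq> 0" "\<And>r. (\<Sum>i<4. x i$r$1 * a i) = 0" by auto
    show False
    proof (rule no_common_kernel_axis_indep[OF inf permuted(1)[OF a(1)], of "x \<circ> swap0 i" "a \<circ> swap0 i"])
      show "X$r$1 = 0" if "X \<in> kern (l \<circ> swap0 i)" for X r using col that permuted(2)[OF a(1)] by simp
      show "(l \<circ> swap0 i) k ((x \<circ> swap0 i) j) = (if k = j then 1 else 0)" if "j < 4" "k < 4" for j k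
        using dual swap_less a(1) that by (auto simp: swap0_def)
      show "(a \<circ> swap0 i) 0 \<noteq> 0" using a by (simp add: swap0_def)
      show "(\<Sum>j<4. (x \<circ> swap0 i) j $ r $ 1 * (a \<circ> swap0 i) j) = 0" for r
        using a(3)[of r] sum.reindex_bij_betw[OF bij_swap0[OF a(1)], of "\<lambda>i. x i$r$1 * a i"] by simp
    qed
  next
    case False
    then obtain i where i: "i < 4" "\<forall>x. (\<forall>k<4. k \<noteq> i \<longrightarrow> l k x = 0) \<longrightarrow> l i x = 0" by blast
    show False
    proof (rule no_common_kernel_axis_dep[OF inf permuted(1)[OF i(1)]])
      show "X$r$1 = 0" if "X \<in> kern (l \<circ> swap0 i)" for X r using col that permuted(2)[OF i(1)] by simp
      show "(l \<circ> swap0 i) 0 X = 0" if X: "\<And>k. k \<in> {1, 2, 3} \<Longrightarrow> (l \<circ> swap0 i) k X = 0" for X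
      proof -
        have "l k X = 0" if k: "k < 4" "k \<noteq> i" for k
        proof -
          have "swap0 i k \<in> {1, 2, 3}" using k i(1) by (auto simp: swap0_def)
          from X[OF this] show ?thesis by (simp add: swap0_def split: if_splits)
        qed
        then have "l i X = 0" using i(2) by blast
        then show ?thesis by (simp add: swap0_def)
      qed
    qed
  qed
qed

lemma exists_basis_matrix:
  fixes v :: "'a::field^3"
  assumes "v \<noteq> 0"
  obtains Q where "det Q \<noteq> 0" "Q *v axis 1 1 = v"
proof -
  obtain r where r: "v$r \<noteq> 0" using assms by (auto simp: vec_eq_iff)
  \<comment> \<open>\<open>v\<close> is completed by the unit vectors at the two positions other
    than \<open>r\<close>; their cyclic order makes the determinant exactly
    \<open>v$r\<close>.\<close>
  define Q :: "'a^3^3" where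
    "Q = (\<chi> i j. if j = 1 then v$i else if (j = 2 \<and> i = r + 1) \<or> (j = 3 \<and> i = r + 2) then 1 else 0)"
  have mod3: "4 = (1::3)" "5 = (2::3)" by simp_all
  have "det Q = v$r" unfolding det_3 Q_def using exhaust_3[of r]
    by (elim disjE; hypsubst; simp add: mod3)
  moreover have "Q *v axis 1 1 = v" by (simp add: vec_eq_iff mat_vec_3 axis_def Q_def)
  ultimately show ?thesis using r by (intro that[of Q]) simp_all
qed

lemma no_common_kernel:
  fixes l m n :: "nat \<Rightarrow> 'a::field^3^3 \<Rightarrow> 'a"
  assumes inf: "infinite (UNIV :: 'a set)" and ps: "product_sum \<kappa> l m n"
    and v: "v \<noteq> 0" "\<And>X. X \<in> kern l \<Longrightarrow> X *v v = 0"
  shows False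
proof -
  obtain Q where Q: "det Q \<noteq> 0" "Q *v axis 1 1 = v" using exists_basis_matrix[OF v(1)] .
  obtain Q' where Q': "Q ** Q' = mat 1" "Q' ** Q = mat 1" "det Q' \<noteq> 0" using det_mult_nonzero_inverse[OF Q(1)] .
  have ps': "product_sum (\<kappa> * (det (mat 1 :: 'a^3^3) * det Q')) (\<lambda>k X. l k (mat 1 ** X ** Q')) (\<lambda>k X. m k (mat 1 ** X ** Q'))
    (\<lambda>k X. n k (mat 1 ** X ** Q'))" using product_sum_sandwich[OF ps _ Q'(3), of "mat 1"] by simp
  show False
  proof (rule no_common_kernel_axis[OF inf ps'])
    fix X r assume "X \<in> kern (\<lambda>k X. l k (mat 1 ** X ** Q'))"
    then have "X ** Q' \<in> kern l" by (simp add: kern_def)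
    then have "(X ** Q') *v (Q *v axis 1 1) = 0" using v(2) Q(2) by simp
    then have "X *v axis 1 1 = 0" using Q'(2) by (simp add: matrix_vector_mul_assoc matrix_mul_assoc[symmetric])
    then have "(X *v axis 1 1)$r = 0" by simp
    then show "X$r$1 = 0" by (simp add: mat_vec_3 axis_def)
  qed
qed

lemma no_common_left_kernel:
  fixes l m n :: "nat \<Rightarrow> 'a::field^3^3 \<Rightarrow> 'a"
  assumes inf: "infinite (UNIV :: 'a set)" and ps: "product_sum \<kappa> l m n"
    and v: "v \<noteq> 0" "\<And>X. X \<in> kern l \<Longrightarrow> transpose X *v v = 0"
  shows False
proof (rule no_common_kernel[OF inf product_sum_transpose[OF ps] v(1)])
  fix X assume "X \<in> kern (\<lambda>k X. l k (transpose X))"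
  then have "transpose X \<in> kern l" by (simp add: kern_def)
  then have "transpose (transpose X) *v v = 0" by (rule v(2))
  then show "X *v v = 0" by (simp only: transpose_transpose)
qed

section \<open>Spaces with a two by two block of zeros\<close>

lemma zero_block_det:
  assumes "zero_block Y" and "\<And>i j. (i, j) \<notin> {(3,3), (2,3), (3,1), (2,1)} \<Longrightarrow> N$i$j = 0"
  shows "det (Y + msc s N) = s * (Y$1$1 * Y$2$2 * N$3$3 - Y$1$1 * Y$3$2 * N$2$3 + Y$1$3 * Y$3$2 * N$2$1 - Y$1$3 * Y$2$2 * N$3$1)
    - s^2 * (Y$1$2 * (N$2$1 * N$3$3 - N$2$3 * N$3$1))"
  using assms(1) assms(2)[of 1 1] assms(2)[of 1 2] assms(2)[of 1 3] assms(2)[of 2 2] assms(2)[of 3 2]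
  by (simp add: det_3 zero_block_def algebra_simps power2_eq_square)

text \<open>If \<open>l 0\<close>, \dots, \<open>l 3\<close> cut out the space of all matrices with the zero block, then on the
  space cut out by the last three of them the determinant splits into \<open>l 0\<close>, a form in the first row and a
  form in the second column; replacing \<open>l 0\<close> by the latter gives a space with a common left kernel vector.\<close>

lemma no_zero_block_oriented:
  fixes l m n :: "nat \<Rightarrow> 'a::field^3^3 \<Rightarrow> 'a"
  assumes inf: "infinite (UNIV :: 'a set)" and ps: "product_sum \<kappa> l m n"
    and kern: "kern l = Collect zero_block"
    and N: "N \<noteq> 0" "\<And>i j. (i, j) \<notin> {(3,3), (2,3), (3,1), (2,1)} \<Longrightarrow> N$i$j = 0"
      "\<And>k. k \<in> {1, 2, 3} \<Longrightarrow> l k N = 0" "l 0 N \<noteq> 0"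
    and coeff: "\<And>Y. zero_block Y \<Longrightarrow> \<kappa> * (Y$1$1 * Y$2$2 * N$3$3 - Y$1$1 * Y$3$2 * N$2$3 + Y$1$3 * Y$3$2 * N$2$1
        - Y$1$3 * Y$2$2 * N$3$1) = l 0 N * (m 0 Y * n 0 Y)"
    and coeff2: "\<And>Y. zero_block Y \<Longrightarrow> - \<kappa> * (Y$1$2 * (N$2$1 * N$3$3 - N$2$3 * N$3$1)) = l 0 N * (m 0 Y * n 0 N + m 0 N * n 0 Y)"
    and m: "\<And>Y. zero_block Y \<Longrightarrow> Y$1$1 = 0 \<Longrightarrow> Y$1$3 = 0 \<Longrightarrow> m 0 Y = 0"
    and n: "\<And>Y. zero_block Y \<Longrightarrow> Y$2$2 = 0 \<Longrightarrow> Y$3$2 = 0 \<Longrightarrow> n 0 Y = 0"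
  shows False
proof -
  have lin: "lin (l k)" "lin (m k)" "lin (n k)" if "k < 4" for k using ps that by (auto simp: product_sum_def)
  have \<kappa>: "\<kappa> \<noteq> 0" using ps by (simp add: product_sum_def)
  define \<gamma>1 \<gamma>3 \<beta>2 \<beta>3 where "\<gamma>1 = m 0 (munit 1 1)" "\<gamma>3 = m 0 (munit 1 3)" "\<beta>2 = n 0 (munit 2 2)" "\<beta>3 = n 0 (munit 3 2)"
  note defs = this
  note add = lin_add[OF lin(2)] lin_add[OF lin(3)]
  have mn0: "n 0 (munit 1 1) = 0" "n 0 (munit 1 3) = 0" "m 0 (munit 2 2) = 0" "m 0 (munit 3 2) = 0"
    by (auto intro!: m n simp: zero_block_def)
  \<comment> \<open>The block of \<open>N\<close> is, up to signs and a scalar, the outer product of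
    the coefficients of \<open>m 0\<close> on the first row and of \<open>n 0\<close> on the second
    column.\<close>
  have r: "\<kappa> * N$3$3 = l 0 N * (\<gamma>1 * \<beta>2)" "- \<kappa> * N$2$3 = l 0 N * (\<gamma>1 * \<beta>3)" "\<kappa> * N$2$1 = l 0 N * (\<gamma>3 * \<beta>3)"
      "- \<kappa> * N$3$1 = l 0 N * (\<gamma>3 * \<beta>2)"
    using coeff[of "munit 1 1 + munit 2 2"] coeff[of "munit 1 1 + munit 3 2"]
      coeff[of "munit 1 3 + munit 3 2"] coeff[of "munit 1 3 + munit 2 2"]
    by (simp_all add: zero_block_def add mn0 defs)
  have nz: "\<not> (\<gamma>1 = 0 \<and> \<gamma>3 = 0)" "\<not> (\<beta>2 = 0 \<and> \<beta>3 = 0)"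
  proof -
    have "N$3$3 = 0 \<and> N$2$3 = 0 \<and> N$2$1 = 0 \<and> N$3$1 = 0" if "(\<gamma>1 = 0 \<and> \<gamma>3 = 0) \<or> (\<beta>2 = 0 \<and> \<beta>3 = 0)"
      using that r \<kappa> by auto
    moreover have "\<not> (N$3$3 = 0 \<and> N$2$3 = 0 \<and> N$2$1 = 0 \<and> N$3$1 = 0)"
      using N(1) N(2)[of 1 1] N(2)[of 1 2] N(2)[of 1 3] N(2)[of 2 2] N(2)[of 3 2] by (auto simp: vec_eq_iff forall_3)
    ultimately show "\<not> (\<gamma>1 = 0 \<and> \<gamma>3 = 0)" "\<not> (\<beta>2 = 0 \<and> \<beta>3 = 0)" by blast+
  qed
  \<comment> \<open>At these units the entry (1,2) is zero, so the coefficient of \<open>s^2\<close>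
    in the determinant vanishes, and so does \<open>n 0\<close>.\<close>
  have "\<gamma>1 * n 0 N = 0" "\<gamma>3 * n 0 N = 0"
    using coeff2[of "munit 1 1"] coeff2[of "munit 1 3"] N(4) by (simp_all add: zero_block_def mn0 defs)
  then have nN: "n 0 N = 0" using nz(1) by auto
  have nY: "n 0 Y = \<beta>2 * Y$2$2 + \<beta>3 * Y$3$2" if Y: "zero_block Y" for Y
  proof -
    define Z where "Z = Y - (msc (Y$2$2) (munit 2 2) + msc (Y$3$2) (munit 3 2))"
    have "n 0 Z = 0" using Y by (intro n) (simp_all add: Z_def zero_block_def)
    then show ?thesis using lin by (simp add: Z_def lin_diff lin_add lin_msc defs mult.commute)
  qed
  define l' n' where "l' = l(0 := n 0)" "n' = n(0 := l 0)"
  have ps': "product_sum \<kappa> l' m n'"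
  proof -
    have "(\<Sum>k<4. l' k X * m k X * n' k X) = (\<Sum>k<4. l k X * m k X * n k X)" for X
      by (rule sum.cong) (auto simp: l'_n'_def mult_ac)
    then show ?thesis using ps by (auto simp: product_sum_def l'_n'_def)
  qed
  \<comment> \<open>The coefficient vector of \<open>n 0\<close> on the second column; by the
    relations \<open>r\<close> it also annihilates the columns of \<open>N\<close>.\<close>
  define v :: "'a^3" where "v = vector [0, \<beta>2, \<beta>3]"
  show False
  proof (rule no_common_left_kernel[OF inf ps', of v])
    show "v \<noteq> 0" using nz(2) by (auto simp: v_def vec_eq_iff forall_3)
    fix X assume X: "X \<in> kern l'"
    define s where "s = l 0 X / l 0 N"
    define Y where "Y = X - msc s N"
    have "l k Y = 0" if "k < 4" for k
    proof (cases "k = 0")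
      case True
      then show ?thesis using lin N(4) by (simp add: Y_def lin_diff lin_msc s_def)
    next
      case False
      then have "k \<in> {1, 2, 3}" using that by auto
      moreover have "l' k X = 0" using X that by (simp add: kern_def)
      ultimately show ?thesis using False N(3) lin[OF that] by (simp add: Y_def lin_diff lin_msc l'_n'_def)
    qed
    then have Y: "zero_block Y" using kern by (auto simp: kern_def)
    have "l' 0 X = 0" using X by (simp add: kern_def)
    then have "n 0 X = 0" by (simp add: l'_n'_def)
    then have "n 0 Y = 0" using lin nN by (simp add: Y_def lin_diff lin_msc)
    then have c2: "\<beta>2 * Y$2$2 + \<beta>3 * Y$3$2 = 0" using nY[OF Y] by simp
    have "\<kappa> * (\<beta>2 * N$2$1 + \<beta>3 * N$3$1) = \<beta>2 * (\<kappa> * N$2$1) - \<beta>3 * (- \<kappa> * N$3$1)" by (simp add: algebra_simps)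
    also have "\<dots> = 0" unfolding r by (simp add: algebra_simps)
    finally have c1: "\<beta>2 * N$2$1 + \<beta>3 * N$3$1 = 0" using \<kappa> by simp
    have "\<kappa> * (\<beta>2 * N$2$3 + \<beta>3 * N$3$3) = \<beta>3 * (\<kappa> * N$3$3) - \<beta>2 * (- \<kappa> * N$2$3)" by (simp add: algebra_simps)
    also have "\<dots> = 0" unfolding r by (simp add: algebra_simps)
    finally have c3: "\<beta>2 * N$2$3 + \<beta>3 * N$3$3 = 0" using \<kappa> by simp
    have X_eq: "X = Y + msc s N" by (simp add: Y_def)
    have "\<beta>2 * X$2$1 + \<beta>3 * X$3$1 = s * (\<beta>2 * N$2$1 + \<beta>3 * N$3$1)"
      using Y by (simp add: X_eq zero_block_def algebra_simps)
    moreover have "\<beta>2 * X$2$2 + \<beta>3 * X$3$2 = 0"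
      using N(2)[of 2 2] N(2)[of 3 2] c2 by (simp add: X_eq)
    moreover have "\<beta>2 * X$2$3 + \<beta>3 * X$3$3 = s * (\<beta>2 * N$2$3 + \<beta>3 * N$3$3)"
      using Y by (simp add: X_eq zero_block_def algebra_simps)
    ultimately show "transpose X *v v = 0" using c1 c3
      by (simp add: vec_eq_iff forall_3 mat_vec_3 transpose_def v_def mult.commute del: transpose_matrix_vector)
  qed
qed

text \<open>\<open>N\<close> spans the direction added to \<open>kern l\<close> by dropping
  \<open>l 0\<close>. Along \<open>Y + msc s N\<close> only the first product survives, and
  comparing coefficients makes \<open>m 0 * n 0\<close> proportional to a bilinear form in the first
  row and the second column, so each factor belongs to one of the two.\<close>

lemma no_zero_block:
  fixes l m n :: "nat \<Rightarrow> 'a::field^3^3 \<Rightarrow> 'a"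
  assumes inf: "infinite (UNIV :: 'a set)" and ps: "product_sum \<kappa> l m n"
    and zb: "\<And>X. X \<in> kern l \<Longrightarrow> zero_block X"
  shows False
proof -
  have lin: "lin (l k)" "lin (m k)" "lin (n k)" if "k < 4" for k using ps that by (auto simp: product_sum_def)
  define S :: "(3 \<times> 3) set" where "S = {(3,3), (2,3), (3,1), (2,1)}"
  have less4: "k = 0 \<or> k \<in> {1, 2, 3}" if "k < 4" for k :: nat using that by auto
  obtain N where N: "N \<noteq> 0" "\<And>i j. (i, j) \<notin> S \<Longrightarrow> N$i$j = 0" "\<And>k. k \<in> {1, 2, 3} \<Longrightarrow> l k N = 0"
  proof -
    have "length [l 1, l 2, l 3] < card S" by (simp add: S_def)
    moreover have "\<And>f. f \<in> set [l 1, l 2, l 3] \<Longrightarrow> lin f" using lin by auto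
    ultimately obtain N where "N \<noteq> 0" "\<forall>i j. (i, j) \<notin> S \<longrightarrow> N$i$j = 0" "\<forall>f\<in>set [l 1, l 2, l 3]. f N = 0"
      using common_zero_supported by blast
    then show thesis by (intro that[of N]) auto
  qed
  have N0: "l 0 N \<noteq> 0"
  proof
    assume "l 0 N = 0"
    then have "N \<in> kern l" using N(3) less4 by (auto simp: kern_def)
    then have "zero_block N" by (rule zb)
    then have "N = 0" using N(2) by (simp add: vec_eq_iff forall_3 zero_block_def S_def)
    with N show False by simp
  qed
  \<comment> \<open>Both spaces have dimension five: \<open>Y\<close> and the four units of the
    block admit a nontrivial combination in \<open>kern l\<close>, where the block entries
    vanish.\<close>
  have kern: "kern l = Collect zero_block"
  proof (intro equalityI subsetI)
    fix Y :: "'a^3^3" assume "Y \<in> Collect zero_block"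
    then have Y: "zero_block Y" by simp
    define I :: "(3 \<times> 3) set" where "I = insert (1, 1) S"
    define Z where "Z p = (if p = (1, 1) then Y else munit (fst p) (snd p))" for p
    have "length (map l [0..<4]) < card I" by (simp add: I_def S_def)
    moreover have "\<And>f. f \<in> set (map l [0..<4]) \<Longrightarrow> lin f" using lin by auto
    ultimately obtain a where a: "\<exists>p\<in>I. a p \<noteq> 0"
      "\<forall>f\<in>set (map l [0..<4]). f (\<Sum>p\<in>I. msc (a p) (Z p)) = 0"
      using common_zero_combination[of I "map l [0..<4]" Z] by auto
    define W where "W = (\<Sum>p\<in>I. msc (a p) (Z p))"
    have Wk: "W \<in> kern l" using a(2) by (auto simp: W_def kern_def)
    have W: "W = msc (a (1,1)) Y + (msc (a (3,3)) (munit 3 3) + (msc (a (2,3)) (munit 2 3)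
        + (msc (a (3,1)) (munit 3 1) + msc (a (2,1)) (munit 2 1))))"
      by (simp add: W_def I_def S_def Z_def)
    have "a (3,3) = 0" "a (2,3) = 0" "a (3,1) = 0" "a (2,1) = 0"
      using zb[OF Wk] Y by (simp_all add: W zero_block_def)
    then have "a (1,1) \<noteq> 0" "W = msc (a (1,1)) Y" using a(1) W by (auto simp: I_def S_def)
    then show "Y \<in> kern l" using Wk lin by (auto simp: kern_def lin_msc)
  qed (use zb in simp)
  have NS: "\<And>i j. (i, j) \<notin> {(3,3), (2,3), (3,1), (2,1)} \<Longrightarrow> N$i$j = 0" using N(2) by (simp add: S_def)
  have coeffs: "\<kappa> * (Y$1$1 * Y$2$2 * N$3$3 - Y$1$1 * Y$3$2 * N$2$3 + Y$1$3 * Y$3$2 * N$2$1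
        - Y$1$3 * Y$2$2 * N$3$1) = l 0 N * (m 0 Y * n 0 Y)"
      "- \<kappa> * (Y$1$2 * (N$2$1 * N$3$3 - N$2$3 * N$3$1)) = l 0 N * (m 0 Y * n 0 N + m 0 N * n 0 Y)"
    if Y: "zero_block Y" for Y
  proof -
    define q where "q = Y$1$1 * Y$2$2 * N$3$3 - Y$1$1 * Y$3$2 * N$2$3 + Y$1$3 * Y$3$2 * N$2$1 - Y$1$3 * Y$2$2 * N$3$1"
    define e where "e = Y$1$2 * (N$2$1 * N$3$3 - N$2$3 * N$3$1)"
    have "0 + s * (\<kappa> * q - l 0 N * (m 0 Y * n 0 Y)) + s^2 * (- \<kappa> * e - l 0 N * (m 0 Y * n 0 N + m 0 N * n 0 Y))
       + s^3 * (- l 0 N * m 0 N * n 0 N) = 0" for s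
    proof -
      have Yk: "l k Y = 0" if "k < 4" for k
      proof -
        have "Y \<in> kern l" using Y kern by simp
        then show ?thesis using that by (simp add: kern_def)
      qed
      have zero: "l k (Y + msc s N) = 0" if "k \<in> {1, 2, 3}" for k
      proof -
        have "k < 4" using that by auto
        then show ?thesis using N(3)[OF that] Yk lin by (simp add: lin_add lin_msc)
      qed
      have "(\<Sum>k<4. l k (Y + msc s N) * m k (Y + msc s N) * n k (Y + msc s N))
          = s * l 0 N * (m 0 Y + s * m 0 N) * (n 0 Y + s * n 0 N)"
        using lin N(3) Yk by (simp add: sum_lessThan_4 lin_add lin_msc)
      moreover have "\<kappa> * det (Y + msc s N) = (\<Sum>k<4. l k (Y + msc s N) * m k (Y + msc s N) * n k (Y + msc s N))"
        using ps unfolding product_sum_def by blast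
      moreover have "det (Y + msc s N) = s * q - s^2 * e"
        using zero_block_det[OF Y NS, of s] by (simp add: q_def e_def)
      ultimately show ?thesis by (simp add: algebra_simps power2_eq_square power3_eq_cube)
    qed
    from cubic_zero(2,3)[OF inf this] show "\<kappa> * q = l 0 N * (m 0 Y * n 0 Y)"
      "- \<kappa> * e = l 0 N * (m 0 Y * n 0 N + m 0 N * n 0 Y)" by simp_all
  qed
  define Vr where "Vr = {Y :: 'a^3^3. zero_block Y \<and> Y$2$2 = 0 \<and> Y$3$2 = 0}"
  define Vc where "Vc = {Y :: 'a^3^3. zero_block Y \<and> Y$1$1 = 0 \<and> Y$1$3 = 0}"
  have sub: "msubspace Vr" "msubspace Vc" by (auto simp: msubspace_def Vr_def Vc_def zero_block_def)
  have "m 0 Y * n 0 Y = 0" if "Y \<in> Vr" for Y using coeffs(1)[of Y] N0 that by (simp add: Vr_def)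
  then have r: "(\<forall>Y\<in>Vr. m 0 Y = 0) \<or> (\<forall>Y\<in>Vr. n 0 Y = 0)"
    using product_zero_on_subspace[OF inf sub(1), of "m 0" "n 0"] lin by simp
  have "m 0 Y * n 0 Y = 0" if "Y \<in> Vc" for Y using coeffs(1)[of Y] N0 that by (simp add: Vc_def)
  then have c: "(\<forall>Y\<in>Vc. m 0 Y = 0) \<or> (\<forall>Y\<in>Vc. n 0 Y = 0)"
    using product_zero_on_subspace[OF inf sub(2), of "m 0" "n 0"] lin by simp
  \<comment> \<open>A factor vanishing on both spaces would vanish on their sum, and the bilinear
    form, whose coefficients are up to sign the entries of \<open>N\<close>, would be zero.\<close>
  have not_both: False if f: "f \<in> {m 0, n 0}" "\<forall>Y\<in>Vr. f Y = 0" "\<forall>Y\<in>Vc. f Y = 0" for f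
  proof -
    have \<kappa>: "\<kappa> \<noteq> 0" using ps by (simp add: product_sum_def)
    have lf: "lin f" using f(1) lin by auto
    have "f (X + Y) = 0" if "X \<in> Vr" "Y \<in> Vc" for X Y using f that lf by (simp add: lin_add)
    then have z: "m 0 (X + Y) * n 0 (X + Y) = 0" if "X \<in> Vr" "Y \<in> Vc" for X Y using f(1) that by auto
    have V: "munit 1 1 \<in> Vr" "munit 1 3 \<in> Vr" "munit 2 2 \<in> Vc" "munit 3 2 \<in> Vc"
      by (simp_all add: Vr_def Vc_def zero_block_def)
    have "N$3$3 = 0" "N$2$3 = 0" "N$2$1 = 0" "N$3$1 = 0"
      using coeffs(1)[of "munit 1 1 + munit 2 2"] coeffs(1)[of "munit 1 1 + munit 3 2"]
        coeffs(1)[of "munit 1 3 + munit 3 2"] coeffs(1)[of "munit 1 3 + munit 2 2"] z V \<kappa>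
      by (simp_all add: zero_block_def)
    then have "N = 0" using N(2) by (simp add: vec_eq_iff forall_3 S_def)
    with N show False by simp
  qed
  have ps': "product_sum \<kappa> l n m" using ps by (auto simp: product_sum_def mult_ac)
  from r c not_both[of "m 0"] not_both[of "n 0"]
  consider "\<forall>Y\<in>Vc. m 0 Y = 0" "\<forall>Y\<in>Vr. n 0 Y = 0" | "\<forall>Y\<in>Vc. n 0 Y = 0" "\<forall>Y\<in>Vr. m 0 Y = 0" by blast
  then show False
  proof cases
    case 1
    then show False
      by (intro no_zero_block_oriented[OF inf ps kern N(1) NS N(3) N0 coeffs]) (auto simp: Vc_def Vr_def)
  next
    case 2
    have coeffs': "\<kappa> * (Y$1$1 * Y$2$2 * N$3$3 - Y$1$1 * Y$3$2 * N$2$3 + Y$1$3 * Y$3$2 * N$2$1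
        - Y$1$3 * Y$2$2 * N$3$1) = l 0 N * (n 0 Y * m 0 Y)"
      "- \<kappa> * (Y$1$2 * (N$2$1 * N$3$3 - N$2$3 * N$3$1)) = l 0 N * (n 0 Y * m 0 N + n 0 N * m 0 Y)"
      if "zero_block Y" for Y
      using coeffs[OF that] by (simp_all only: mult.commute add.commute)
    from 2 show False
      by (intro no_zero_block_oriented[OF inf ps' kern N(1) NS N(3) N0 coeffs']) (auto simp: Vc_def Vr_def)
  qed
qed

section \<open>No four products over an infinite field\<close>

lemma not_product_sum:
  fixes l m n :: "nat \<Rightarrow> 'a::field^3^3 \<Rightarrow> 'a"
  assumes inf: "infinite (UNIV :: 'a set)"
  shows "\<not> product_sum \<kappa> l m n"
proof
  assume ps: "product_sum \<kappa> l m n"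
  have lin: "lin (l k)" if "k < 4" for k using ps that by (simp add: product_sum_def)
  have sing: "det X = 0" if "X \<in> kern l" for X
  proof -
    have "\<kappa> * det X = (\<Sum>k<4. l k X * m k X * n k X)" using ps unfolding product_sum_def by blast
    also have "\<dots> = 0" using that by (intro sum.neutral) (simp add: kern_def)
    finally show ?thesis using ps by (simp add: product_sum_def)
  qed
  have "(\<exists>v. v \<noteq> 0 \<and> (\<forall>X\<in>kern l. X *v v = 0)) \<or> (\<exists>v. v \<noteq> 0 \<and> (\<forall>X\<in>kern l. transpose X *v v = 0)) \<or>
    (\<exists>P Q. det P \<noteq> 0 \<and> det Q \<noteq> 0 \<and> (\<forall>X\<in>kern l. zero_block (P ** X ** Q)))"
    by (rule singular_space_cases[OF inf lin sing])
  then show False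
  proof (elim disjE exE conjE)
    fix v :: "'a^3"
    assume "v \<noteq> 0" "\<forall>X\<in>kern l. X *v v = 0"
    then show False using no_common_kernel[OF inf ps, of v] by simp
  next
    fix v :: "'a^3"
    assume v: "v \<noteq> 0" "\<forall>X\<in>kern l. transpose X *v v = 0"
    show False by (rule no_common_left_kernel[OF inf ps v(1)]) (rule v(2)[rule_format])
  next
    fix P Q :: "'a^3^3"
    assume 3: "det P \<noteq> 0" "det Q \<noteq> 0" "\<forall>X\<in>kern l. zero_block (P ** X ** Q)"
    obtain P' where P': "P ** P' = mat 1" "P' ** P = mat 1" "det P' \<noteq> 0" using det_mult_nonzero_inverse[OF 3(1)] .
    obtain Q' where Q': "Q ** Q' = mat 1" "Q' ** Q = mat 1" "det Q' \<noteq> 0" using det_mult_nonzero_inverse[OF 3(2)] .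
    show False
    proof (rule no_zero_block[OF inf product_sum_sandwich[OF ps P'(3) Q'(3)]])
      fix X assume "X \<in> kern (\<lambda>k X. l k (P' ** X ** Q'))"
      then have "P' ** X ** Q' \<in> kern l" by (simp add: kern_def)
      then have "zero_block (P ** (P' ** X ** Q') ** Q)" using 3 by blast
      moreover have "P ** (P' ** X ** Q') ** Q = (P ** P') ** X ** (Q' ** Q)" by (simp add: matrix_mul_assoc)
      ultimately show "zero_block X" using P' Q' by simp
    qed
  qed
qed

section \<open>Evaluation of formal polynomials\<close>

text \<open>The map \<open>\<phi>\<close> on coefficients permits evaluation at points of an
  extension, where an infinite field is available even if the field of coefficients is
  finite.\<close>

locale ring_homomorphism =
  fixes \<phi> :: "'a::comm_ring_1 \<Rightarrow> 'b::comm_ring_1"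
  assumes hom_zero [simp]: "\<phi> 0 = 0" and hom_one [simp]: "\<phi> 1 = 1"
    and hom_add: "\<phi> (a + b) = \<phi> a + \<phi> b" and hom_mult: "\<phi> (a * b) = \<phi> a * \<phi> b"
begin

definition eval_mpoly :: "('v::finite \<Rightarrow> 'b) \<Rightarrow> ('v, 'a) mpoly \<Rightarrow> 'b" where
  "eval_mpoly x p = (\<Sum>m\<in>Poly_Mapping.keys p. \<phi> (Poly_Mapping.lookup p m) * (\<Prod>v\<in>UNIV. x v ^ Poly_Mapping.lookup m v))"

lemma eval_mpoly_superset:
  assumes "finite A" "Poly_Mapping.keys p \<subseteq> A"
  shows "eval_mpoly x p = (\<Sum>m\<in>A. \<phi> (Poly_Mapping.lookup p m) * (\<Prod>v\<in>UNIV. x v ^ Poly_Mapping.lookup m v))"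
  unfolding eval_mpoly_def using assms by (intro sum.mono_neutral_left) (auto simp: in_keys_iff)

lemma eval_mpoly_zero [simp]: "eval_mpoly x 0 = 0"
  by (simp add: eval_mpoly_def)

lemma eval_mpoly_add: "eval_mpoly x (p + q) = eval_mpoly x p + eval_mpoly x q"
proof -
  let ?A = "Poly_Mapping.keys p \<union> Poly_Mapping.keys q"
  show ?thesis
    using keys_add[of p q]
    by (simp add: eval_mpoly_superset[of ?A] lookup_add hom_add algebra_simps sum.distrib)
qed

lemma eval_mpoly_sum: "eval_mpoly x (\<Sum>i\<in>I. p i) = (\<Sum>i\<in>I. eval_mpoly x (p i))"
  by (induction I rule: infinite_finite_induct) (simp_all add: eval_mpoly_add)

lemma eval_mpoly_single:
  "eval_mpoly x (Poly_Mapping.single m a) = \<phi> a * (\<Prod>v\<in>UNIV. x v ^ Poly_Mapping.lookup m v)"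
  using eval_mpoly_superset[of "{m}" "Poly_Mapping.single m a" x] by simp

lemma eval_mpoly_mult: "eval_mpoly x (p * q) = eval_mpoly x p * eval_mpoly x q"
proof -
  have decomp: "p = (\<Sum>m\<in>Poly_Mapping.keys p. Poly_Mapping.single m (Poly_Mapping.lookup p m))" for p :: "('v, 'a) mpoly"
  proof (rule poly_mapping_eqI)
    fix k
    have "(\<Sum>m\<in>Poly_Mapping.keys p. Poly_Mapping.lookup p m when m = k) = Poly_Mapping.lookup p k"
      by (cases "k \<in> Poly_Mapping.keys p") (auto simp: when_def in_keys_iff)
    then show "Poly_Mapping.lookup p k = Poly_Mapping.lookup
        (\<Sum>m\<in>Poly_Mapping.keys p. Poly_Mapping.single m (Poly_Mapping.lookup p m)) k"
      by (simp add: lookup_sum lookup_single)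
  qed
  have "p * q = (\<Sum>m\<in>Poly_Mapping.keys p. \<Sum>n\<in>Poly_Mapping.keys q.
      Poly_Mapping.single (m + n) (Poly_Mapping.lookup p m * Poly_Mapping.lookup q n))"
    by (subst decomp[of p], subst decomp[of q]) (simp add: sum_product mult_single)
  then show ?thesis
    by (simp add: eval_mpoly_sum eval_mpoly_single hom_mult eval_mpoly_def[of x p] eval_mpoly_def[of x q]
        sum_product lookup_add power_add prod.distrib mult_ac)
qed

lemma eval_mpoly_uminus: "eval_mpoly x (- p) = - eval_mpoly x p"
  using eval_mpoly_add[of x p "- p"] by (simp add: eq_neg_iff_add_eq_0 add.commute)

lemma eval_mpoly_diff: "eval_mpoly x (p - q) = eval_mpoly x p - eval_mpoly x q"
  using eval_mpoly_add[of x p "- q"] by (simp add: eval_mpoly_uminus)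

lemma eval_mpoly_Const: "eval_mpoly x (Const a) = \<phi> a"
  by (simp add: Const_def eval_mpoly_single)

lemma eval_mpoly_Var: "eval_mpoly x (Var v) = x v"
proof -
  have "(\<Prod>w\<in>UNIV. x w ^ Poly_Mapping.lookup (Poly_Mapping.single v 1) w) = (\<Prod>w\<in>UNIV. if w = v then x w else 1)"
    by (intro prod.cong) (auto simp: lookup_single when_def)
  then show ?thesis by (simp add: Var_def eval_mpoly_single)
qed

definition eval_at :: "'b^3^3 \<Rightarrow> (3 \<times> 3, 'a) mpoly \<Rightarrow> 'b" where
  "eval_at X = eval_mpoly (\<lambda>p. X $ fst p $ snd p)"

lemma eval_at_det3: "eval_at X det3 = det X"
  by (simp add: eval_at_def det3_def det_3 generic_matrix_def eval_mpoly_add eval_mpoly_diff eval_mpoly_mult eval_mpoly_Var)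

lemma lin_eval_at:
  assumes "linear_form_in V p"
  shows "lin (\<lambda>X. eval_at X p)"
proof -
  obtain c where "p = (\<Sum>v\<in>V. Const (c v) * Var v)" using assms by (auto simp: linear_form_in_def)
  then show ?thesis
    by (simp add: lin_def eval_at_def eval_mpoly_sum eval_mpoly_mult eval_mpoly_Const eval_mpoly_Var
        algebra_simps sum.distrib sum_distrib_left)
qed

end

section \<open>Extension of scalars to the rational function field\<close>

lemma infinite_poly_fract: "infinite (UNIV :: 'a::field poly fract set)"
proof -
  have "inj (\<lambda>n. Fract (monom (1::'a) n) 1)"
    by (rule injI) (auto simp: eq_fract monom_eq_iff')
  then show ?thesis using finite_imageD infinite_UNIV_nat by (metis finite_subset subset_UNIV)
qed

interpretation const_fract: ring_homomorphism "\<lambda>a :: 'a::field. Fract [:a:] 1"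
  by standard (simp_all add: Zero_fract_def One_fract_def pCons_one mult.commute)

lemma det3_product_decomposition:
  fixes l :: "nat \<Rightarrow> nat \<Rightarrow> (3 \<times> 3, 'a::field) mpoly"
  assumes lf: "\<And>i j. i < r \<Longrightarrow> j < 3 \<Longrightarrow> linear_form_in UNIV (l i j)"
    and eq: "det3 = (\<Sum>i<r. \<Prod>j<3. l i j)"
  shows "5 \<le> r"
proof (rule ccontr)
  assume r: "\<not> 5 \<le> r"
  \<comment> \<open>Fewer than four products are padded with zero forms.\<close>
  define f where "f j i X = (if i < r then const_fract.eval_at X (l i j) else 0)" for j i X
  have "product_sum 1 (f 0) (f 1) (f 2)"
    unfolding product_sum_def
  proof (intro conjI allI impI)
    have "lin (f j i)" if "j < 3" for j i
      using const_fract.lin_eval_at[OF lf, of i j] that by (cases "i < r") (simp_all add: f_def[abs_def])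
    then show "lin (f 0 i)" "lin (f 1 i)" "lin (f 2 i)" for i by simp_all
    fix X :: "'a poly fract ^ 3 ^ 3"
    have prod3: "(\<Prod>j<3. l i j) = l i 0 * l i 1 * l i 2" for i by (simp add: numeral_3_eq_3 numeral_2_eq_2)
    have "1 * det X = const_fract.eval_at X (\<Sum>i<r. \<Prod>j<3. l i j)"
      unfolding eq[symmetric] const_fract.eval_at_det3 by simp
    also have "\<dots> = (\<Sum>i<r. f 0 i X * f 1 i X * f 2 i X)"
      unfolding prod3 const_fract.eval_at_def const_fract.eval_mpoly_sum
      by (intro sum.cong) (simp_all add: f_def const_fract.eval_at_def const_fract.eval_mpoly_mult)
    also have "\<dots> = (\<Sum>i<4. f 0 i X * f 1 i X * f 2 i X)"
      using r by (intro sum.mono_neutral_left) (auto simp: f_def)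
    finally show "1 * det X = (\<Sum>i<4. f 0 i X * f 1 i X * f 2 i X)" .
  qed simp
  then show False using not_product_sum[OF infinite_poly_fract] by blast
qed

section \<open>Linear forms in rows and the five products\<close>

lemma Const_simps: "Const 0 = 0" "Const 1 = 1" "Const (- a) = - Const a" "Const (a + b) = Const a + Const b"
  by (simp_all add: Const_def single_add single_uminus)

lemma linear_form_in_mono:
  assumes "linear_form_in V p" "V \<subseteq> W" "finite W"
  shows "linear_form_in W p"
proof -
  obtain c where c: "p = (\<Sum>v\<in>V. Const (c v) * Var v)" using assms(1) by (auto simp: linear_form_in_def)
  have "p = (\<Sum>v\<in>W. Const (if v \<in> V then c v else 0) * Var v)"
    unfolding c using assms by (intro sum.mono_neutral_cong_left) (auto simp: Const_simps)
  then show ?thesis unfolding linear_form_in_def by (rule exI[of _ "\<lambda>v. if v \<in> V then c v else 0"])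
qed

lemma linear_form_in_row: "linear_form_in UNIV (Const a * Var (i, 1) + Const b * Var (i, 2) + Const c * Var (i, 3 :: 3) :: ('m::finite \<times> 3, 'a::comm_ring_1) mpoly)"
proof (rule linear_form_in_mono[of "{(i, 1), (i, 2), (i, 3)}"])
  show "linear_form_in {(i, 1), (i, 2), (i, 3)} (Const a * Var (i, 1) + Const b * Var (i, 2) + Const c * Var (i, 3 :: 3) :: ('m \<times> 3, 'a) mpoly)"
    unfolding linear_form_in_def
    by (intro exI[of _ "\<lambda>v. if snd v = 1 then a else if snd v = 2 then b else c"]) (simp add: add.assoc)
qed auto

text \<open>Each inner list is one product; its factor at position \<open>j\<close> is the linear
  form with these coefficients in row \<open>j + 1\<close>. The intended values are
  \<open>h = 1/2\<close> and \<open>k = 2h = 1\<close>.\<close>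

definition derksen_coeffs :: "'a::field \<Rightarrow> 'a \<Rightarrow> ('a \<times> 'a \<times> 'a) list list" where
  "derksen_coeffs h k =
    [[(0, h, h), (1, -1, 0), (1, 1, 0)],
     [(h, h, 0), (0, 1, -1), (0, 1, 1)],
     [(0, k, 0), (-1, 0, 1), (1, 0, 1)],
     [(0, -h, h), (1, 1, 0), (-1, 1, 0)],
     [(h, -h, 0), (0, 1, 1), (0, -1, 1)]]"

lemma det3_five_products:
  assumes "CHAR('a::field) \<noteq> 2"
  shows "\<exists>l :: nat \<Rightarrow> nat \<Rightarrow> (3 \<times> 3, 'a) mpoly.
    (\<forall>i<5. \<forall>j<3. linear_form_in UNIV (l i j)) \<and> det3 = (\<Sum>i<5. \<Prod>j<3. l i j)"
proof -
  have two: "(2::'a) \<noteq> 0"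
  proof
    assume "(2::'a) = 0"
    then have "of_nat 2 = (0::'a)" by simp
    then have "CHAR('a) dvd 2" by (simp only: of_nat_eq_0_iff_char_dvd)
    then have "CHAR('a) \<in> {1, 2}" using two_is_prime_nat prime_nat_iff by blast
    then show False using assms by simp
  qed
  define h :: 'a where "h = 1 / 2"
  define k where "k = h + h"
  have "k = 1" using two by (simp add: k_def h_def field_simps)
  then have one: "Const k = (1 :: (3 \<times> 3, 'a) mpoly)" by (simp add: Const_simps)
  have double: "Const k = (Const h + Const h :: (3 \<times> 3, 'a) mpoly)" by (simp only: k_def Const_simps)
  define l :: "nat \<Rightarrow> nat \<Rightarrow> (3 \<times> 3, 'a) mpoly" where
    "l i j = (case derksen_coeffs h k ! i ! j of (a, b, c) \<Rightarrow>
      let r = (if j = 0 then 1 else if j = 1 then 2 else 3)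
      in Const a * Var (r, 1) + Const b * Var (r, 2) + Const c * Var (r, 3))" for i j
  have "linear_form_in UNIV (l i j)" for i j
    by (simp add: l_def Let_def split_def linear_form_in_row)
  moreover have "det3 = (\<Sum>i<5. \<Prod>j<3. l i j)"
  proof -
    \<comment> \<open>With \<open>k\<close> written as \<open>h + h\<close> this is an identity over
      commutative rings for any \<open>h\<close>, so no division enters the expansion.\<close>
    have "(\<Sum>i<5. \<Prod>j<3. l i j) = Const k * det3"
      by (simp add: numeral_eq_Suc l_def derksen_coeffs_def Const_simps double det3_def det_3 generic_matrix_def algebra_simps)
    then show ?thesis by (simp add: one)
  qed
  ultimately show ?thesis by blast
qed

theorem mainTheorem6:
  shows "product_rank 3 (det3 :: (3 \<times> 3, 'a::field) mpoly) \<ge> 5 \<and>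
         tensor_rank (det3 :: (3 \<times> 3, 'a) mpoly) \<ge> 5 \<and>
         (CHAR('a) \<noteq> 2 \<longrightarrow> product_rank 3 (det3 :: (3 \<times> 3, 'a) mpoly) = 5)"
proof (intro conjI impI)
  have five: "(5::enat) = enat 5" by (simp add: numeral_eq_enat)
  show lower: "product_rank 3 (det3 :: (3 \<times> 3, 'a) mpoly) \<ge> 5"
    unfolding product_rank_def five
  proof (rule Inf_greatest, clarify)
    fix r and l :: "nat \<Rightarrow> nat \<Rightarrow> (3 \<times> 3, 'a) mpoly"
    assume "\<forall>i<r. \<forall>j<3. linear_form_in UNIV (l i j)" "det3 = (\<Sum>i<r. \<Prod>j<3. l i j)"
    then have "5 \<le> r" by (intro det3_product_decomposition[of r l]) auto
    then show "enat 5 \<le> enat r" by simp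
  qed
  show "tensor_rank (det3 :: (3 \<times> 3, 'a) mpoly) \<ge> 5"
    unfolding tensor_rank_def five
  proof (rule Inf_greatest, clarify)
    fix r and l :: "nat \<Rightarrow> 3 \<Rightarrow> (3 \<times> 3, 'a) mpoly"
    assume lf: "\<forall>k<r. \<forall>i. linear_form_in ({i} \<times> UNIV) (l k i)" and eq: "det3 = (\<Sum>k<r. \<Prod>i\<in>UNIV. l k i)"
    define l' where "l' k j = l k (if j = 0 then 1 else if j = 1 then 2 else 3)" for k and j :: nat
    have prods: "(\<Prod>i\<in>UNIV. l k i) = (\<Prod>j<3. l' k j)" for k
      unfolding UNIV_3 by (simp add: l'_def numeral_3_eq_3 numeral_2_eq_2 mult.assoc)
    have "det3 = (\<Sum>k<r. \<Prod>j<3. l' k j)" using eq unfolding prods .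
    moreover have "linear_form_in UNIV (l k i)" if "k < r" for k i
      by (rule linear_form_in_mono[of "{i} \<times> UNIV"]) (use lf that in auto)
    ultimately have "5 \<le> r" by (intro det3_product_decomposition[of r l']) (auto simp: l'_def)
    then show "enat 5 \<le> enat r" by simp
  qed
  assume "CHAR('a) \<noteq> 2"
  then have "product_rank 3 (det3 :: (3 \<times> 3, 'a) mpoly) \<le> 5"
    unfolding product_rank_def five
    by (intro Inf_lower CollectI exI[of _ 5] conjI refl det3_five_products)
  then show "product_rank 3 (det3 :: (3 \<times> 3, 'a) mpoly) = 5" using lower by (rule antisym)
qed

end
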